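(* Let $P:\mathbb{C}^{\mathrm{op}}\to\mathbf{Pos}$ be a bounded existential implicational doctrine such that each fiber $P(A)$ is non-trivial (i.e. not a singleton), and whose base category $\mathbb{C}$ is small. Then the doctrine $\underrightarrow{P}:\underline{\mathbb{C}}^{\mathrm{op}}\to\mathbf{Pos}$ constructed from $P$ as described in the context is consistent.
   Context: **Doctrines.** $\mathbf{Pos}$ is the category of posets and monotone maps. A doctrine is a functor $P:\mathbb{C}^{\mathrm{op}}\to\mathbf{Pos}$ where $\mathbb{C}$ (the base category) has finite products; $\mathbf{t}$ is the terminal object, $!_A:A\to\mathbf{t}$ the unique arrow, $P(A)$ a fiber, $P(f)$ a reindexing. $P$ is primary if every $P(A)$ has finite meets (including $\top$), preserved by reindexings. $P$ is implicational if every $P(A)$ has finite meets and a Heyting implication $\to$ (i.e. $P(A)$ is cartesian closed), all preserved by reindexings. $P$ is bounded if every $P(A)$ has a top and a bottom element, preserved by reindexings. A primary doctrine $P$ is existential if for all objects $B,C$ the map $P(\mathrm{pr}_1):P(C)\to P(C\times B)$ has a left adjoint $\exists^B_C$ satisfying Beck–Chevalley ($\exists^B_C P(f\times \mathrm{id}_B)=P(f)\exists^B_{C'}$ for all $f:C\to C'$) and Frobenius reciprocity ($\exists^B_C(\alpha\wedge P(\mathrm{pr}_1)\beta)=\exists^B_C(\alpha)\wedge\beta$). **Consistent.** A doctrine $R:\mathbb{D}^{\mathrm{op}}\to\mathbf{Pos}$ is consistent if there are $a,b\in R(\mathbf{t})$ with $a\nleq b$. **Construction of $\underline{P}$.** Let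 $P$ be implicational existential with $\mathbb{C}$ small. Let $\Lambda$ be the cardinality of $\bigsqcup_{X\in\mathrm{ob}\,\mathbb{C}}P(X)$, regarded as an initial ordinal. Let $J$ be the set of finite lists (including the empty list) of pairwise distinct elements of $\mathrm{ob}\,\mathbb{C}\times\Lambda$, preordered by inclusion of the sets of entries. For $\bar X=((X_1,x_1),\dots,(X_n,x_n))\in J$ write $\Pi\bar X=X_1\times\dots\times X_n$ (terminal if $\bar X=\emptyset$; $\mathbf{t}\times A$ is identified with $A$). For $\bar X\le\bar Y$ let $\pi_{\bar Y\bar X}:\Pi\bar Y\to\Pi\bar X$ be the map whose $i$-th component is the projection onto the factor given by the unique entry of $\bar Y$ equal to $(X_i,x_i)$. The category $\underline{\mathbb{C}}$ has the objects of $\mathbb{C}$; an arrow $A\dashrightarrow B$ is a class $[f,\bar X]$ with $\bar X\in J$ and $f:\Pi\bar X\times A\to B$ in $\mathbb{C}$, where $[f,\bar X]=[f',\bar Y]$ iff there is $\bar Z\ge\bar X,\bar Y$ with $f\circ(\pi_{\bar Z\bar X}\times\mathrm{id}_A)=f'\circ(\pi_{\bar Z\bar Y}\times\mathrm{id}_A)$; composition is computed over a common list by $[g,\bar Z]\circ[f,\bar Z]=[g\circ\langle\mathrm{pr}_{\Pi\bar Z},f\rangle,\bar Z]$. The doctrine $\underline{P}:\underline{\mathbb{C}}^{\mathrm{op}}\to\mathbf{Pos}$ has as elements of $\underline{P}(A)$ the classes $[\alpha,\bar X]$ with $\alpha\in P(\Pi\bar X\times A)$, where $[\alpha,\bar X]\le[\beta,\bar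 Y]$ (resp. $=$) iff there is $\bar Z\ge\bar X,\bar Y$ with $P(\pi_{\bar Z\bar X}\times\mathrm{id}_A)\alpha\le P(\pi_{\bar Z\bar Y}\times\mathrm{id}_A)\beta$ (resp. $=$) in $P(\Pi\bar Z\times A)$; reindexing over a common list is $\underline{P}([f,\bar Z])[\beta,\bar Z]=[P(\langle\mathrm{pr}_{\Pi\bar Z},f\rangle)\beta,\bar Z]$. It is the directed colimit over $J$ of the doctrines obtained by adding to $P$ a constant of sort $\Pi\bar X$; it is implicational and existential, with operations computed over a common list and $\underline{\exists}^B_A[\varphi,\bar X]=[\exists^B_{\Pi\bar X\times A}\varphi,\bar X]$. **Construction of $\underrightarrow{P}$.** For each object $B$ fix a listing $([\varphi^B_j,\bar X^{(B,j)}])_{j\in\Lambda}$ (repetitions allowed) of all elements of $\underline{P}(B)$, with fixed representatives $\bar X^{(B,j)}=((X_1^{(B,j)},x_1^{(B,j)}),\dots,(X_{n}^{(B,j)},x_{n}^{(B,j)}))\in J$, $n=n^{(B,j)}$, and $\varphi^B_j\in P(\Pi\bar X^{(B,j)}\times B)$. Define recursively $d^B_j$ as the smallest ordinal strictly greater than all $d^B_h$ with $h<j$ and than all $x_a^{(B,k)}$ with $k\le j$, $1\le a\le n^{(B,k)}$; the listings are assumed chosen so that all $d^B_j\in\Lambda$. Let $\bar X^{(B,j)}_\star\in J$ be $\bar X^{(B,j)}$ with $(B,d^B_j)$ appended, let $\psi^B_j=\big(P(\mathrm{pr}_1)\exists^B_{\Pi\bar X^{(B,j)}}\varphi^B_j\to\varphi^B_j\big)\in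 P(\Pi\bar X^{(B,j)}\times B)$ with $\mathrm{pr}_1:\Pi\bar X^{(B,j)}\times B\to\Pi\bar X^{(B,j)}$, and consider $[\psi^B_j,\bar X^{(B,j)}_\star]\in\underline{P}(\mathbf{t})$. For a finite set $\mathcal{U}\subseteq\mathrm{ob}\,\mathbb{C}\times\Lambda$ put $\psi_{\mathcal{U}}=\bigwedge_{(B,j)\in\mathcal{U}}[\psi^B_j,\bar X^{(B,j)}_\star]\in\underline{P}(\mathbf{t})$. The doctrine $\underrightarrow{P}:\underline{\mathbb{C}}^{\mathrm{op}}\to\mathbf{Pos}$ has as elements of $\underrightarrow{P}(A)$ the classes $[a,\mathcal{U}]$ with $\mathcal{U}$ finite and $a\in\underline{P}(A)$, $a\le\underline{P}(!_A)\psi_{\mathcal{U}}$, where $[a,\mathcal{U}]\le[b,\mathcal{V}]$ (resp. $=$) iff there is a finite $\mathcal{W}\supseteq\mathcal{U}\cup\mathcal{V}$ with $a\wedge\underline{P}(!_A)\psi_{\mathcal{W}}\le b\wedge\underline{P}(!_A)\psi_{\mathcal{W}}$ (resp. $=$) in $\underline{P}(A)$; reindexing is induced by that of $\underline{P}$. It is the directed colimit of the doctrines obtained from $\underline{P}$ by adding the axiom $\psi_{\mathcal{U}}$; it is implicational and existential. *)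

theory Defs
  imports "HOL-Algebra.Galois_Connection"
begin

section \<open>Small categories with finite products\<close>

text \<open>Finite products are given by a chosen terminal object and chosen binary products. Hom-sets
  are indexed by source and target; they need not be disjoint.\<close>

record ('o, 'a) fp_cat =
  Obj :: "'o set"
  Hom :: "'o \<Rightarrow> 'o \<Rightarrow> 'a set"
  Idn :: "'o \<Rightarrow> 'a"
  Cmp :: "'a \<Rightarrow> 'a \<Rightarrow> 'a"  (infixr \<open>\<cdot>\<index>\<close> 75)
  Trm :: "'o"
  Prd :: "'o \<Rightarrow> 'o \<Rightarrow> 'o"  (infixl \<open>\<Otimes>\<index>\<close> 80)
  Prj1 :: "'o \<Rightarrow> 'o \<Rightarrow> 'a"
  Prj2 :: "'o \<Rightarrow> 'o \<Rightarrow> 'a"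

locale fp_category =
  fixes C :: "('o, 'a) fp_cat" (structure)
  assumes idn_hom: "A \<in> Obj C \<Longrightarrow> Idn C A \<in> Hom C A A"
    and cmp_hom: "\<lbrakk>A \<in> Obj C; B \<in> Obj C; E \<in> Obj C; f \<in> Hom C A B; g \<in> Hom C B E\<rbrakk>
      \<Longrightarrow> g \<cdot> f \<in> Hom C A E"
    and cmp_idn_right: "\<lbrakk>A \<in> Obj C; B \<in> Obj C; f \<in> Hom C A B\<rbrakk> \<Longrightarrow> f \<cdot> Idn C A = f"
    and cmp_idn_left: "\<lbrakk>A \<in> Obj C; B \<in> Obj C; f \<in> Hom C A B\<rbrakk> \<Longrightarrow> Idn C B \<cdot> f = f"
    and cmp_assoc: "\<lbrakk>A \<in> Obj C; B \<in> Obj C; E \<in> Obj C; F \<in> Obj C;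
      f \<in> Hom C A B; g \<in> Hom C B E; h \<in> Hom C E F\<rbrakk> \<Longrightarrow> (h \<cdot> g) \<cdot> f = h \<cdot> (g \<cdot> f)"
    and trm_obj: "Trm C \<in> Obj C"
    and trm_terminal: "A \<in> Obj C \<Longrightarrow> \<exists>!f. f \<in> Hom C A (Trm C)"
    and prd_obj: "\<lbrakk>A \<in> Obj C; B \<in> Obj C\<rbrakk> \<Longrightarrow> A \<Otimes> B \<in> Obj C"
    and prj1_hom: "\<lbrakk>A \<in> Obj C; B \<in> Obj C\<rbrakk> \<Longrightarrow> Prj1 C A B \<in> Hom C (A \<Otimes> B) A"
    and prj2_hom: "\<lbrakk>A \<in> Obj C; B \<in> Obj C\<rbrakk> \<Longrightarrow> Prj2 C A B \<in> Hom C (A \<Otimes> B) B"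
    and prd_universal: "\<lbrakk>A \<in> Obj C; B \<in> Obj C; X \<in> Obj C; f \<in> Hom C X A; g \<in> Hom C X B\<rbrakk>
      \<Longrightarrow> \<exists>!h. h \<in> Hom C X (A \<Otimes> B) \<and> Prj1 C A B \<cdot> h = f \<and> Prj2 C A B \<cdot> h = g"

definition bang :: "('o, 'a) fp_cat \<Rightarrow> 'o \<Rightarrow> 'a" where
  "bang C A = (THE f. f \<in> Hom C A (Trm C))"

text \<open>\<open>pairing C X A B f g\<close> is the arrow from \<open>X\<close> to the product of \<open>A\<close> and \<open>B\<close> with components
  \<open>f\<close> and \<open>g\<close>.\<close>

definition pairing :: "('o, 'a) fp_cat \<Rightarrow> 'o \<Rightarrow> 'o \<Rightarrow> 'o \<Rightarrow> 'a \<Rightarrow> 'a \<Rightarrow> 'a" where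
  "pairing C X A B f g =
    (THE h. h \<in> Hom C X (A \<Otimes>\<^bsub>C\<^esub> B) \<and> Prj1 C A B \<cdot>\<^bsub>C\<^esub> h = f \<and> Prj2 C A B \<cdot>\<^bsub>C\<^esub> h = g)"

text \<open>\<open>times_id C X Y A f\<close> is the product of \<open>f\<close>, an arrow from \<open>X\<close> to \<open>Y\<close>, with the identity
  of \<open>A\<close>.\<close>

definition times_id :: "('o, 'a) fp_cat \<Rightarrow> 'o \<Rightarrow> 'o \<Rightarrow> 'o \<Rightarrow> 'a \<Rightarrow> 'a" where
  "times_id C X Y A f = pairing C (X \<Otimes>\<^bsub>C\<^esub> A) Y A (f \<cdot>\<^bsub>C\<^esub> Prj1 C X A) (Prj2 C X A)"


section \<open>Doctrines\<close>

record ('o, 'a, 'p) doctrine_data =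
  Base :: "('o, 'a) fp_cat"
  Fib :: "'o \<Rightarrow> 'p gorder"
  Rdx :: "'a \<Rightarrow> 'p \<Rightarrow> 'p"

locale doctrine =
  fixes D :: "('o, 'a, 'p) doctrine_data"
  assumes base: "fp_category (Base D)"
    and fib_order: "A \<in> Obj (Base D) \<Longrightarrow> partial_order (Fib D A)"
    and rdx_closed: "\<lbrakk>A \<in> Obj (Base D); B \<in> Obj (Base D); f \<in> Hom (Base D) A B\<rbrakk>
      \<Longrightarrow> Rdx D f \<in> carrier (Fib D B) \<rightarrow> carrier (Fib D A)"
    and rdx_mono: "\<lbrakk>A \<in> Obj (Base D); B \<in> Obj (Base D); f \<in> Hom (Base D) A B\<rbrakk>
      \<Longrightarrow> isotone (Fib D B) (Fib D A) (Rdx D f)"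
    and rdx_idn: "\<lbrakk>A \<in> Obj (Base D); \<alpha> \<in> carrier (Fib D A)\<rbrakk> \<Longrightarrow> Rdx D (Idn (Base D) A) \<alpha> = \<alpha>"
    and rdx_cmp: "\<lbrakk>A \<in> Obj (Base D); B \<in> Obj (Base D); E \<in> Obj (Base D);
      f \<in> Hom (Base D) A B; g \<in> Hom (Base D) B E; \<alpha> \<in> carrier (Fib D E)\<rbrakk>
      \<Longrightarrow> Rdx D (g \<cdot>\<^bsub>Base D\<^esub> f) \<alpha> = Rdx D f (Rdx D g \<alpha>)"

locale primary_doctrine = doctrine +
  assumes fib_meets: "A \<in> Obj (Base D) \<Longrightarrow> lower_semilattice (Fib D A)"
    and fib_top: "A \<in> Obj (Base D) \<Longrightarrow> \<exists>\<tau>. greatest (Fib D A) \<tau> (carrier (Fib D A))"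
    and rdx_meet: "\<lbrakk>A \<in> Obj (Base D); B \<in> Obj (Base D); f \<in> Hom (Base D) A B;
      \<alpha> \<in> carrier (Fib D B); \<beta> \<in> carrier (Fib D B)\<rbrakk>
      \<Longrightarrow> Rdx D f (\<alpha> \<sqinter>\<^bsub>Fib D B\<^esub> \<beta>) = Rdx D f \<alpha> \<sqinter>\<^bsub>Fib D A\<^esub> Rdx D f \<beta>"
    and rdx_top: "\<lbrakk>A \<in> Obj (Base D); B \<in> Obj (Base D); f \<in> Hom (Base D) A B\<rbrakk>
      \<Longrightarrow> Rdx D f \<top>\<^bsub>Fib D B\<^esub> = \<top>\<^bsub>Fib D A\<^esub>"

definition is_himp :: "'p gorder \<Rightarrow> 'p \<Rightarrow> 'p \<Rightarrow> 'p \<Rightarrow> bool" where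
  "is_himp L \<alpha> \<beta> \<gamma> \<longleftrightarrow> \<gamma> \<in> carrier L \<and>
    (\<forall>\<xi> \<in> carrier L. \<xi> \<sqsubseteq>\<^bsub>L\<^esub> \<gamma> \<longleftrightarrow> \<xi> \<sqinter>\<^bsub>L\<^esub> \<alpha> \<sqsubseteq>\<^bsub>L\<^esub> \<beta>)"

definition himp :: "'p gorder \<Rightarrow> 'p \<Rightarrow> 'p \<Rightarrow> 'p" where
  "himp L \<alpha> \<beta> = (THE \<gamma>. is_himp L \<alpha> \<beta> \<gamma>)"

locale implicational_doctrine = primary_doctrine +
  assumes fib_himp: "\<lbrakk>A \<in> Obj (Base D); \<alpha> \<in> carrier (Fib D A); \<beta> \<in> carrier (Fib D A)\<rbrakk>
      \<Longrightarrow> \<exists>\<gamma>. is_himp (Fib D A) \<alpha> \<beta> \<gamma>"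
    and rdx_himp: "\<lbrakk>A \<in> Obj (Base D); B \<in> Obj (Base D); f \<in> Hom (Base D) A B;
      \<alpha> \<in> carrier (Fib D B); \<beta> \<in> carrier (Fib D B)\<rbrakk>
      \<Longrightarrow> Rdx D f (himp (Fib D B) \<alpha> \<beta>) = himp (Fib D A) (Rdx D f \<alpha>) (Rdx D f \<beta>)"

locale bounded_doctrine = doctrine +
  assumes bounded_top: "A \<in> Obj (Base D) \<Longrightarrow> \<exists>\<tau>. greatest (Fib D A) \<tau> (carrier (Fib D A))"
    and bounded_bottom: "A \<in> Obj (Base D) \<Longrightarrow> \<exists>\<tau>. least (Fib D A) \<tau> (carrier (Fib D A))"
    and bounded_rdx_top: "\<lbrakk>A \<in> Obj (Base D); B \<in> Obj (Base D); f \<in> Hom (Base D) A B\<rbrakk>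
      \<Longrightarrow> Rdx D f \<top>\<^bsub>Fib D B\<^esub> = \<top>\<^bsub>Fib D A\<^esub>"
    and bounded_rdx_bottom: "\<lbrakk>A \<in> Obj (Base D); B \<in> Obj (Base D); f \<in> Hom (Base D) A B\<rbrakk>
      \<Longrightarrow> Rdx D f \<bottom>\<^bsub>Fib D B\<^esub> = \<bottom>\<^bsub>Fib D A\<^esub>"

definition left_adjoint ::
  "('o, 'a, 'p) doctrine_data \<Rightarrow> 'o \<Rightarrow> 'o \<Rightarrow> ('p \<Rightarrow> 'p) \<Rightarrow> bool" where
  "left_adjoint D B E l \<longleftrightarrow> galois_connection
    \<lparr>orderA = Fib D (E \<Otimes>\<^bsub>Base D\<^esub> B), orderB = Fib D E, lower = l, upper = Rdx D (Prj1 (Base D) E B)\<rparr>"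

text \<open>On the carrier the left adjoint is unique, so the choice below is harmless.\<close>

definition Exq :: "('o, 'a, 'p) doctrine_data \<Rightarrow> 'o \<Rightarrow> 'o \<Rightarrow> 'p \<Rightarrow> 'p" where
  "Exq D B E = (SOME l. left_adjoint D B E l)"

locale existential_doctrine = primary_doctrine +
  assumes exq_adjoint: "\<lbrakk>B \<in> Obj (Base D); E \<in> Obj (Base D)\<rbrakk> \<Longrightarrow> \<exists>l. left_adjoint D B E l"
    and beck_chevalley: "\<lbrakk>B \<in> Obj (Base D); E \<in> Obj (Base D); E' \<in> Obj (Base D);
      f \<in> Hom (Base D) E E'; \<alpha> \<in> carrier (Fib D (E' \<Otimes>\<^bsub>Base D\<^esub> B))\<rbrakk>
      \<Longrightarrow> Exq D B E (Rdx D (times_id (Base D) E E' B f) \<alpha>) = Rdx D f (Exq D B E' \<alpha>)"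
    and frobenius: "\<lbrakk>B \<in> Obj (Base D); E \<in> Obj (Base D);
      \<alpha> \<in> carrier (Fib D (E \<Otimes>\<^bsub>Base D\<^esub> B)); \<beta> \<in> carrier (Fib D E)\<rbrakk>
      \<Longrightarrow> Exq D B E (\<alpha> \<sqinter>\<^bsub>Fib D (E \<Otimes>\<^bsub>Base D\<^esub> B)\<^esub> Rdx D (Prj1 (Base D) E B) \<beta>)
          = Exq D B E \<alpha> \<sqinter>\<^bsub>Fib D E\<^esub> \<beta>"

definition consistent :: "('o, 'a, 'p) doctrine_data \<Rightarrow> bool" where
  "consistent R \<longleftrightarrow> (\<exists>a \<in> carrier (Fib R (Trm (Base R))). \<exists>b \<in> carrier (Fib R (Trm (Base R))).
    \<not> a \<sqsubseteq>\<^bsub>Fib R (Trm (Base R))\<^esub> b)"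


section \<open>Lists of sorted constants\<close>

text \<open>The cardinal \<open>\<Lambda>\<close> is given by a well-order \<open>r\<close>; its ordinals are the elements of
  \<open>Field r\<close>.\<close>

definition ctxs :: "('o, 'a) fp_cat \<Rightarrow> 'l rel \<Rightarrow> ('o \<times> 'l) list set" where
  "ctxs C r = {X. distinct X \<and> set X \<subseteq> Obj C \<times> Field r}"

text \<open>The product of the sorts of a list is nested to the left and starts with the terminal object,
  so that appending an entry to the list is the same as multiplying by its sort on the right.
  Recursion is therefore on the reversed list.\<close>

primrec rev_Prod :: "('o, 'a) fp_cat \<Rightarrow> ('o \<times> 'l) list \<Rightarrow> 'o" where
  "rev_Prod C [] = Trm C"
| "rev_Prod C (e # es) = rev_Prod C es \<Otimes>\<^bsub>C\<^esub> fst e"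

definition Prod :: "('o, 'a) fp_cat \<Rightarrow> ('o \<times> 'l) list \<Rightarrow> 'o" where
  "Prod C X = rev_Prod C (rev X)"

lemma Prod_Nil [simp]: "Prod C [] = Trm C"
  by (simp add: Prod_def)

lemma Prod_snoc [simp]: "Prod C (X @ [(B, x)]) = Prod C X \<Otimes>\<^bsub>C\<^esub> B"
  by (simp add: Prod_def)

primrec rev_entry_proj :: "('o, 'a) fp_cat \<Rightarrow> ('o \<times> 'l) list \<Rightarrow> 'o \<times> 'l \<Rightarrow> 'a" where
  "rev_entry_proj C [] e = undefined"
| "rev_entry_proj C (e' # es) e =
    (if e = e' then Prj2 C (rev_Prod C es) (fst e')
     else rev_entry_proj C es e \<cdot>\<^bsub>C\<^esub> Prj1 C (rev_Prod C es) (fst e'))"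

definition entry_proj :: "('o, 'a) fp_cat \<Rightarrow> ('o \<times> 'l) list \<Rightarrow> 'o \<times> 'l \<Rightarrow> 'a" where
  "entry_proj C Y e = rev_entry_proj C (rev Y) e"

primrec rev_ctx_proj :: "('o, 'a) fp_cat \<Rightarrow> ('o \<times> 'l) list \<Rightarrow> ('o \<times> 'l) list \<Rightarrow> 'a" where
  "rev_ctx_proj C Y [] = bang C (Prod C Y)"
| "rev_ctx_proj C Y (e # es) =
    pairing C (Prod C Y) (rev_Prod C es) (fst e) (rev_ctx_proj C Y es) (entry_proj C Y e)"

text \<open>\<open>ctx_proj C Y X\<close> is the tuple of the projections of \<open>Y\<close> onto the entries of \<open>X\<close>.\<close>

definition ctx_proj :: "('o, 'a) fp_cat \<Rightarrow> ('o \<times> 'l) list \<Rightarrow> ('o \<times> 'l) list \<Rightarrow> 'a" where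
  "ctx_proj C Y X = rev_ctx_proj C Y (rev X)"

definition wk :: "('o, 'a) fp_cat \<Rightarrow> ('o \<times> 'l) list \<Rightarrow> ('o \<times> 'l) list \<Rightarrow> 'o \<Rightarrow> 'a" where
  "wk C Y X A = times_id C (Prod C Y) (Prod C X) A (ctx_proj C Y X)"

text \<open>\<open>graph_of C Z A B f\<close> is the arrow \<open>\<langle>pr\<^sub>1, f\<rangle>\<close> for \<open>f\<close> from \<open>\<Pi>Z \<times> A\<close> to \<open>B\<close>.\<close>

definition graph_of :: "('o, 'a) fp_cat \<Rightarrow> ('o \<times> 'l) list \<Rightarrow> 'o \<Rightarrow> 'o \<Rightarrow> 'a \<Rightarrow> 'a" where
  "graph_of C Z A B f =
    pairing C (Prod C Z \<Otimes>\<^bsub>C\<^esub> A) (Prod C Z) B (Prj1 C (Prod C Z) A) f"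


section \<open>Adding constants of every sort\<close>

definition arr_rel :: "('o, 'a) fp_cat \<Rightarrow> 'l rel \<Rightarrow> 'o \<Rightarrow> 'o \<Rightarrow> ('a \<times> ('o \<times> 'l) list) rel" where
  "arr_rel C r A B = {((f, X), (g, Y)). X \<in> ctxs C r \<and> Y \<in> ctxs C r \<and>
    f \<in> Hom C (Prod C X \<Otimes>\<^bsub>C\<^esub> A) B \<and> g \<in> Hom C (Prod C Y \<Otimes>\<^bsub>C\<^esub> A) B \<and>
    (\<exists>Z \<in> ctxs C r. set X \<union> set Y \<subseteq> set Z \<and> f \<cdot>\<^bsub>C\<^esub> wk C Z X A = g \<cdot>\<^bsub>C\<^esub> wk C Z Y A)}"

text \<open>An equivalence class of pairs does not determine its source and target, so these are recorded
  in the arrow.\<close>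

type_synonym ('o, 'a, 'l) uarr = "'o \<times> 'o \<times> ('a \<times> ('o \<times> 'l) list) set"

definition uarr ::
  "('o, 'a) fp_cat \<Rightarrow> 'l rel \<Rightarrow> 'o \<Rightarrow> 'o \<Rightarrow> 'a \<Rightarrow> ('o \<times> 'l) list \<Rightarrow> ('o, 'a, 'l) uarr" where
  "uarr C r A B f X = (A, B, arr_rel C r A B `` {(f, X)})"

text \<open>In composition and in the reindexings below, the union is over all ways of presenting the
  arguments over a common list; every such presentation yields the same class.\<close>

definition ucat :: "('o, 'a) fp_cat \<Rightarrow> 'l rel \<Rightarrow> ('o, ('o, 'a, 'l) uarr) fp_cat" where
  "ucat C r = \<lparr>
    Obj = Obj C,
    Hom = (\<lambda>A B. {uarr C r A B f X | f X. X \<in> ctxs C r \<and> f \<in> Hom C (Prod C X \<Otimes>\<^bsub>C\<^esub> A) B}),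
    Idn = (\<lambda>A. uarr C r A A (Prj2 C (Trm C) A) []),
    Cmp = (\<lambda>(_, E, G) (A, B, F). (A, E,
      \<Union> {arr_rel C r A E `` {(g \<cdot>\<^bsub>C\<^esub> graph_of C Z A B f, Z)} | f g Z. (f, Z) \<in> F \<and> (g, Z) \<in> G})),
    Trm = Trm C,
    Prd = Prd C,
    Prj1 = (\<lambda>A B. uarr C r (A \<Otimes>\<^bsub>C\<^esub> B) A (Prj1 C A B \<cdot>\<^bsub>C\<^esub> Prj2 C (Trm C) (A \<Otimes>\<^bsub>C\<^esub> B)) []),
    Prj2 = (\<lambda>A B. uarr C r (A \<Otimes>\<^bsub>C\<^esub> B) B (Prj2 C A B \<cdot>\<^bsub>C\<^esub> Prj2 C (Trm C) (A \<Otimes>\<^bsub>C\<^esub> B)) [])\<rparr>"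

type_synonym ('o, 'p, 'l) uelt = "('p \<times> ('o \<times> 'l) list) set"

definition elt_rel ::
  "('o, 'a, 'p) doctrine_data \<Rightarrow> 'l rel \<Rightarrow> 'o \<Rightarrow> ('p \<times> ('o \<times> 'l) list) rel" where
  "elt_rel D r A = {((\<alpha>, X), (\<beta>, Y)). X \<in> ctxs (Base D) r \<and> Y \<in> ctxs (Base D) r \<and>
    \<alpha> \<in> carrier (Fib D (Prod (Base D) X \<Otimes>\<^bsub>Base D\<^esub> A)) \<and>
    \<beta> \<in> carrier (Fib D (Prod (Base D) Y \<Otimes>\<^bsub>Base D\<^esub> A)) \<and>
    (\<exists>Z \<in> ctxs (Base D) r. set X \<union> set Y \<subseteq> set Z \<and>
      Rdx D (wk (Base D) Z X A) \<alpha> = Rdx D (wk (Base D) Z Y A) \<beta>)}"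

definition uelt ::
  "('o, 'a, 'p) doctrine_data \<Rightarrow> 'l rel \<Rightarrow> 'o \<Rightarrow> 'p \<Rightarrow> ('o \<times> 'l) list \<Rightarrow> ('o, 'p, 'l) uelt" where
  "uelt D r A \<alpha> X = elt_rel D r A `` {(\<alpha>, X)}"

definition ufib :: "('o, 'a, 'p) doctrine_data \<Rightarrow> 'l rel \<Rightarrow> 'o \<Rightarrow> ('o, 'p, 'l) uelt gorder" where
  "ufib D r A = \<lparr>
    carrier = {uelt D r A \<alpha> X | \<alpha> X.
      X \<in> ctxs (Base D) r \<and> \<alpha> \<in> carrier (Fib D (Prod (Base D) X \<Otimes>\<^bsub>Base D\<^esub> A))},
    eq = (=),
    le = (\<lambda>p q. \<exists>(\<alpha>, X) \<in> p. \<exists>(\<beta>, Y) \<in> q. \<exists>Z \<in> ctxs (Base D) r. set X \<union> set Y \<subseteq> set Z \<and>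
      Rdx D (wk (Base D) Z X A) \<alpha> \<sqsubseteq>\<^bsub>Fib D (Prod (Base D) Z \<Otimes>\<^bsub>Base D\<^esub> A)\<^esub> Rdx D (wk (Base D) Z Y A) \<beta>)\<rparr>"

definition udoc :: "('o, 'a, 'p) doctrine_data \<Rightarrow> 'l rel
    \<Rightarrow> ('o, ('o, 'a, 'l) uarr, ('o, 'p, 'l) uelt) doctrine_data" where
  "udoc D r = \<lparr>
    Base = ucat (Base D) r,
    Fib = ufib D r,
    Rdx = (\<lambda>(A, B, F) q.
      \<Union> {uelt D r A (Rdx D (graph_of (Base D) Z A B f) \<beta>) Z | f \<beta> Z. (f, Z) \<in> F \<and> (\<beta>, Z) \<in> q})\<rparr>"


section \<open>Adding the witnessing axioms\<close>

text \<open>A listing assigns to an object \<open>B\<close> and an ordinal \<open>j\<close> in \<open>\<Lambda>\<close> a representative, consisting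
  of a formula and a list of constants, of the \<open>j\<close>-th element of the fiber over \<open>B\<close>.\<close>

type_synonym ('o, 'p, 'l) listing = "'o \<Rightarrow> 'l \<Rightarrow> 'p \<times> ('o \<times> 'l) list"

definition const_indices :: "'l rel \<Rightarrow> ('o, 'p, 'l) listing \<Rightarrow> 'o \<Rightarrow> 'l \<Rightarrow> 'l set" where
  "const_indices r L B j = (\<Union>k \<in> under r j. snd ` set (snd (L B k)))"

text \<open>\<open>wo_rel.suc r S\<close> is the least element of \<open>Field r\<close> strictly above all elements of \<open>S\<close>, if
  there is one.\<close>

definition witness :: "'l rel \<Rightarrow> ('o, 'p, 'l) listing \<Rightarrow> 'o \<Rightarrow> 'l \<Rightarrow> 'l" where
  "witness r L B =
    wo_rel.worec r (\<lambda>d j. wo_rel.suc r (d ` underS r j \<union> const_indices r L B j))"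

lemma witness_rec:
  assumes "Well_order r"
  shows "witness r L B j = wo_rel.suc r (witness r L B ` underS r j \<union> const_indices r L B j)"
proof -
  interpret wo_rel r by (simp add: wo_rel_def assms)
  let ?H = "\<lambda>d j. suc (d ` underS j \<union> const_indices r L B j)"
  have "adm_wo ?H"
    unfolding adm_wo_def by (metis (no_types, lifting) image_cong)
  then have "worec ?H = ?H (worec ?H)"
    by (rule worec_fixpoint)
  then show ?thesis
    unfolding witness_def by (rule fun_cong)
qed

text \<open>The last condition says that every \<open>witness r L B j\<close> exists in \<open>\<Lambda>\<close>.\<close>

definition is_listing :: "('o, 'a, 'p) doctrine_data \<Rightarrow> 'l rel \<Rightarrow> ('o, 'p, 'l) listing \<Rightarrow> bool" where
  "is_listing D r L \<longleftrightarrow> (\<forall>B \<in> Obj (Base D).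
    (\<forall>j \<in> Field r. snd (L B j) \<in> ctxs (Base D) r \<and>
      fst (L B j) \<in> carrier (Fib D (Prod (Base D) (snd (L B j)) \<Otimes>\<^bsub>Base D\<^esub> B))) \<and>
    (\<lambda>j. uelt D r B (fst (L B j)) (snd (L B j))) ` Field r = carrier (Fib (udoc D r) B) \<and>
    (\<forall>j \<in> Field r. AboveS r (witness r L B ` underS r j \<union> const_indices r L B j) \<noteq> {}))"

definition henkin :: "('o, 'a, 'p) doctrine_data \<Rightarrow> ('o, 'p, 'l) listing \<Rightarrow> 'o \<Rightarrow> 'l \<Rightarrow> 'p" where
  "henkin D L B j = (let (\<phi>, X) = L B j; C = Base D in
    himp (Fib D (Prod C X \<Otimes>\<^bsub>C\<^esub> B)) (Rdx D (Prj1 C (Prod C X) B) (Exq D B (Prod C X) \<phi>)) \<phi>)"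

definition star :: "'l rel \<Rightarrow> ('o, 'p, 'l) listing \<Rightarrow> 'o \<Rightarrow> 'l \<Rightarrow> ('o \<times> 'l) list" where
  "star r L B j = snd (L B j) @ [(B, witness r L B j)]"

text \<open>By \<open>Prod_snoc\<close> the formula \<open>henkin D L B j\<close> lies over \<open>Prod (Base D) (star r L B j)\<close>. It is
  transported along the isomorphism from the product of this object with the terminal object.\<close>

definition henkin_elt ::
  "('o, 'a, 'p) doctrine_data \<Rightarrow> 'l rel \<Rightarrow> ('o, 'p, 'l) listing \<Rightarrow> 'o \<times> 'l \<Rightarrow> ('o, 'p, 'l) uelt" where
  "henkin_elt D r L = (\<lambda>(B, j). uelt D r (Trm (Base D))
    (Rdx D (Prj1 (Base D) (Prod (Base D) (star r L B j)) (Trm (Base D))) (henkin D L B j))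
    (star r L B j))"

definition henkin_meet ::
  "('o, 'a, 'p) doctrine_data \<Rightarrow> 'l rel \<Rightarrow> ('o, 'p, 'l) listing \<Rightarrow> ('o \<times> 'l) set \<Rightarrow> ('o, 'p, 'l) uelt" where
  "henkin_meet D r L U = \<Sqinter>\<^bsub>Fib (udoc D r) (Trm (Base (udoc D r)))\<^esub> (henkin_elt D r L ` U)"

definition henkin_at :: "('o, 'a, 'p) doctrine_data \<Rightarrow> 'l rel \<Rightarrow> ('o, 'p, 'l) listing
    \<Rightarrow> 'o \<Rightarrow> ('o \<times> 'l) set \<Rightarrow> ('o, 'p, 'l) uelt" where
  "henkin_at D r L A U = Rdx (udoc D r) (bang (Base (udoc D r)) A) (henkin_meet D r L U)"

definition axiom_sets :: "('o, 'a, 'p) doctrine_data \<Rightarrow> 'l rel \<Rightarrow> ('o \<times> 'l) set set" where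
  "axiom_sets D r = {U. finite U \<and> U \<subseteq> Obj (Base D) \<times> Field r}"

type_synonym ('o, 'p, 'l) helt = "(('o, 'p, 'l) uelt \<times> ('o \<times> 'l) set) set"

definition hdom :: "('o, 'a, 'p) doctrine_data \<Rightarrow> 'l rel \<Rightarrow> ('o, 'p, 'l) listing
    \<Rightarrow> 'o \<Rightarrow> (('o, 'p, 'l) uelt \<times> ('o \<times> 'l) set) set" where
  "hdom D r L A = {(a, U). U \<in> axiom_sets D r \<and> a \<in> carrier (Fib (udoc D r) A) \<and>
    a \<sqsubseteq>\<^bsub>Fib (udoc D r) A\<^esub> henkin_at D r L A U}"

definition helt_rel :: "('o, 'a, 'p) doctrine_data \<Rightarrow> 'l rel \<Rightarrow> ('o, 'p, 'l) listing
    \<Rightarrow> 'o \<Rightarrow> (('o, 'p, 'l) uelt \<times> ('o \<times> 'l) set) rel" where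
  "helt_rel D r L A = {((a, U), (b, V)). (a, U) \<in> hdom D r L A \<and> (b, V) \<in> hdom D r L A \<and>
    (\<exists>W \<in> axiom_sets D r. U \<union> V \<subseteq> W \<and>
      a \<sqinter>\<^bsub>Fib (udoc D r) A\<^esub> henkin_at D r L A W = b \<sqinter>\<^bsub>Fib (udoc D r) A\<^esub> henkin_at D r L A W)}"

definition hfib :: "('o, 'a, 'p) doctrine_data \<Rightarrow> 'l rel \<Rightarrow> ('o, 'p, 'l) listing
    \<Rightarrow> 'o \<Rightarrow> ('o, 'p, 'l) helt gorder" where
  "hfib D r L A = \<lparr>
    carrier = hdom D r L A // helt_rel D r L A,
    eq = (=),
    le = (\<lambda>p q. \<exists>(a, U) \<in> p. \<exists>(b, V) \<in> q. \<exists>W \<in> axiom_sets D r. U \<union> V \<subseteq> W \<and>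
      (a \<sqinter>\<^bsub>Fib (udoc D r) A\<^esub> henkin_at D r L A W)
        \<sqsubseteq>\<^bsub>Fib (udoc D r) A\<^esub> (b \<sqinter>\<^bsub>Fib (udoc D r) A\<^esub> henkin_at D r L A W))\<rparr>"

definition hdoc :: "('o, 'a, 'p) doctrine_data \<Rightarrow> 'l rel \<Rightarrow> ('o, 'p, 'l) listing
    \<Rightarrow> ('o, ('o, 'a, 'l) uarr, ('o, 'p, 'l) helt) doctrine_data" where
  "hdoc D r L = \<lparr>
    Base = Base (udoc D r),
    Fib = hfib D r L,
    Rdx = (\<lambda>f q. \<Union> {helt_rel D r L (fst f) `` {(Rdx (udoc D r) f b, V)} | b V. (b, V) \<in> q})\<rparr>"

end

(* If a finite set of witnessing axioms were inconsistent, choose in it the axiom of (B, j) whose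
   new constant has the largest ordinal: this constant occurs neither in its own formula phi nor in
   the other axioms.  Let chi be the conjunction of the latter.  From
   chi & (Ex phi -> phi) <= bot one gets chi & phi <= bot, hence chi & Ex phi <= bot by
   Frobenius reciprocity, hence chi <= (Ex phi -> phi) and so chi <= bot.  By induction top <= bot
   in some fiber of P, which is non-trivial. *)

theory Submission
  imports Defs
begin

section \<open>Projections between lists of constants\<close>

text \<open>The obstacle is that an entailment in the colimit holds only at some list of constants,
  in no particular order, whereas \<open>Exq\<close> binds only the last factor of a product. The
  fresh constant is therefore moved to the end of the list; this is harmless because lists are
  compared by their sets of entries, and the constant then plays the role of the bound variable. Its
  freshness makes the other axioms weakenings along a first projection, and Beck-Chevalley keeps the
  shape Ex phi -> phi of the chosen axiom at the larger list. Each round ends over a list that still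
  contains the eliminated constant, since weakening along a projection need not reflect the order.
  The induction can thus only arrive at top <= bot over some unspecified list, which is refuted by
  the non-triviality of every fiber.\<close>

context fp_category
begin

lemma bang_hom: "A \<in> Obj C \<Longrightarrow> bang C A \<in> Hom C A (Trm C)"
  unfolding bang_def using trm_terminal by (rule theI')

lemma trm_unique: "\<lbrakk>A \<in> Obj C; f \<in> Hom C A (Trm C); g \<in> Hom C A (Trm C)\<rbrakk> \<Longrightarrow> f = g"
  using trm_terminal by blast

lemma
  assumes "A \<in> Obj C" "B \<in> Obj C" "X \<in> Obj C" "f \<in> Hom C X A" "g \<in> Hom C X B"
  shows pairing_hom: "pairing C X A B f g \<in> Hom C X (A \<Otimes> B)"
    and prj1_pairing: "Prj1 C A B \<cdot> pairing C X A B f g = f"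
    and prj2_pairing: "Prj2 C A B \<cdot> pairing C X A B f g = g"
  using theI'[OF prd_universal[OF assms]] unfolding pairing_def by auto

lemma prd_ext:
  assumes "A \<in> Obj C" "B \<in> Obj C" "X \<in> Obj C" "h \<in> Hom C X (A \<Otimes> B)" "k \<in> Hom C X (A \<Otimes> B)"
    and "Prj1 C A B \<cdot> h = Prj1 C A B \<cdot> k" "Prj2 C A B \<cdot> h = Prj2 C A B \<cdot> k"
  shows "h = k"
proof -
  note c = cmp_hom[OF assms(3) prd_obj[OF assms(1,2)] _ assms(5)]
  have "Prj1 C A B \<cdot> k \<in> Hom C X A" "Prj2 C A B \<cdot> k \<in> Hom C X B"
    by (fact c[OF assms(1) prj1_hom[OF assms(1,2)]] c[OF assms(2) prj2_hom[OF assms(1,2)]])+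
  from prd_universal[OF assms(1-3) this] show ?thesis
    using assms(4-7) by blast
qed

lemma pairing_cmp:
  assumes "A \<in> Obj C" "B \<in> Obj C" "X \<in> Obj C" "Y \<in> Obj C"
    and "f \<in> Hom C X A" "g \<in> Hom C X B" "k \<in> Hom C Y X"
  shows "pairing C X A B f g \<cdot> k = pairing C Y A B (f \<cdot> k) (g \<cdot> k)"
proof -
  note p = pairing_hom[OF assms(1-3,5,6)]
    and fk = cmp_hom[OF assms(4,3,1,7,5)] and gk = cmp_hom[OF assms(4,3,2,7,6)]
  note o = prd_obj[OF assms(1,2)]
  have "Prj1 C A B \<cdot> (pairing C X A B f g \<cdot> k) = f \<cdot> k"
    using cmp_assoc[OF assms(4,3) o assms(1,7) p prj1_hom[OF assms(1,2)]]
      prj1_pairing[OF assms(1,2,3,5,6)] by simp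
  moreover have "Prj2 C A B \<cdot> (pairing C X A B f g \<cdot> k) = g \<cdot> k"
    using cmp_assoc[OF assms(4,3) o assms(2,7) p prj2_hom[OF assms(1,2)]]
      prj2_pairing[OF assms(1,2,3,5,6)] by simp
  ultimately show ?thesis
    using prj1_pairing[OF assms(1,2,4) fk gk] prj2_pairing[OF assms(1,2,4) fk gk]
    by (intro prd_ext[OF assms(1,2,4) cmp_hom[OF assms(4,3) o assms(7) p]
        pairing_hom[OF assms(1,2,4) fk gk]]) simp_all
qed

lemma
  assumes "X \<in> Obj C" "Y \<in> Obj C" "A \<in> Obj C" "f \<in> Hom C X Y"
  shows times_id_hom: "times_id C X Y A f \<in> Hom C (X \<Otimes> A) (Y \<Otimes> A)"
    and prj1_times_id: "Prj1 C Y A \<cdot> times_id C X Y A f = f \<cdot> Prj1 C X A"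
    and prj2_times_id: "Prj2 C Y A \<cdot> times_id C X Y A f = Prj2 C X A"
proof -
  note o = prd_obj[OF assms(1,3)] and p = prj1_hom[OF assms(1,3)] prj2_hom[OF assms(1,3)]
  note c = assms(2,3) o cmp_hom[OF o assms(1,2) p(1) assms(4)] p(2)
  show "times_id C X Y A f \<in> Hom C (X \<Otimes> A) (Y \<Otimes> A)"
    "Prj1 C Y A \<cdot> times_id C X Y A f = f \<cdot> Prj1 C X A"
    "Prj2 C Y A \<cdot> times_id C X Y A f = Prj2 C X A"
    unfolding times_id_def by (fact pairing_hom[OF c] prj1_pairing[OF c] prj2_pairing[OF c])+
qed

lemma times_id_cmp:
  assumes "X \<in> Obj C" "Y \<in> Obj C" "Z \<in> Obj C" "A \<in> Obj C" "f \<in> Hom C X Y" "g \<in> Hom C Y Z"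
  shows "times_id C Y Z A g \<cdot> times_id C X Y A f = times_id C X Z A (g \<cdot> f)"
proof -
  note o = prd_obj[OF assms(1,4)] prd_obj[OF assms(2,4)] prd_obj[OF assms(3,4)]
  note F = times_id_hom[OF assms(1,2,4,5)] and G = times_id_hom[OF assms(2,3,4,6)]
  have gf: "g \<cdot> f \<in> Hom C X Z"
    using assms cmp_hom by blast
  have g: "g \<cdot> Prj1 C Y A \<in> Hom C (Y \<Otimes> A) Z"
    by (rule cmp_hom[OF o(2) assms(2,3) prj1_hom[OF assms(2,4)] assms(6)])
  have "times_id C Y Z A g \<cdot> times_id C X Y A f
      = pairing C (X \<Otimes> A) Z A ((g \<cdot> Prj1 C Y A) \<cdot> times_id C X Y A f) (Prj2 C Y A \<cdot> times_id C X Y A f)"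
    unfolding times_id_def[of C Y Z]
    by (rule pairing_cmp[OF assms(3,4) o(2,1) g prj2_hom[OF assms(2,4)] F])
  also have "(g \<cdot> Prj1 C Y A) \<cdot> times_id C X Y A f = g \<cdot> (f \<cdot> Prj1 C X A)"
    using cmp_assoc[OF o(1,2) assms(2,3) F prj1_hom[OF assms(2,4)] assms(6)] prj1_times_id[OF assms(1,2,4,5)]
    by simp
  also have "\<dots> = (g \<cdot> f) \<cdot> Prj1 C X A"
    using cmp_assoc[OF o(1) assms(1,2,3) prj1_hom[OF assms(1,4)] assms(5,6)] by simp
  also have "Prj2 C Y A \<cdot> times_id C X Y A f = Prj2 C X A"
    by (rule prj2_times_id[OF assms(1,2,4,5)])
  finally show ?thesis
    by (simp add: times_id_def)
qed

lemma rev_Prod_obj: "fst ` set X \<subseteq> Obj C \<Longrightarrow> rev_Prod C X \<in> Obj C"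
  by (induction X) (auto intro: trm_obj prd_obj)

lemma Prod_obj: "fst ` set X \<subseteq> Obj C \<Longrightarrow> Prod C X \<in> Obj C"
  by (simp add: Prod_def rev_Prod_obj)

lemma rev_entry_proj_hom:
  "\<lbrakk>fst ` set X \<subseteq> Obj C; e \<in> set X\<rbrakk> \<Longrightarrow> rev_entry_proj C X e \<in> Hom C (rev_Prod C X) (fst e)"
proof (induction X)
  case (Cons e' X)
  then have "rev_Prod C X \<in> Obj C" "fst e' \<in> Obj C" "fst e \<in> Obj C"
    by (auto simp: rev_Prod_obj)
  with Cons show ?case
    using cmp_hom[OF prd_obj _ _ prj1_hom] by (auto intro: prj2_hom)
qed simp

lemma entry_proj_hom:
  "\<lbrakk>fst ` set X \<subseteq> Obj C; e \<in> set X\<rbrakk> \<Longrightarrow> entry_proj C X e \<in> Hom C (Prod C X) (fst e)"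
  using rev_entry_proj_hom[of "rev X"] by (simp add: Prod_def entry_proj_def)

lemma rev_ctx_proj_hom:
  "\<lbrakk>fst ` set Y \<subseteq> Obj C; set X \<subseteq> set Y\<rbrakk> \<Longrightarrow> rev_ctx_proj C Y X \<in> Hom C (Prod C Y) (rev_Prod C X)"
proof (induction X)
  case (Cons e X)
  then have "rev_Prod C X \<in> Obj C" "fst e \<in> Obj C"
    by (auto intro!: rev_Prod_obj)
  with Cons show ?case
    by (auto intro!: pairing_hom entry_proj_hom Prod_obj)
qed (simp add: bang_hom Prod_obj)

lemma ctx_proj_hom:
  "\<lbrakk>fst ` set Y \<subseteq> Obj C; set X \<subseteq> set Y\<rbrakk> \<Longrightarrow> ctx_proj C Y X \<in> Hom C (Prod C Y) (Prod C X)"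
  using rev_ctx_proj_hom[of Y "rev X"] by (simp add: Prod_def ctx_proj_def)

text \<open>The head entry is read off by the second projection, any other one after projecting the
  head away; the two equations of a pairing match these two cases.\<close>

lemma rev_entry_proj_ctx_proj:
  assumes "fst ` set Y \<subseteq> Obj C"
  shows "\<lbrakk>set X \<subseteq> set Y; e \<in> set X\<rbrakk> \<Longrightarrow> rev_entry_proj C X e \<cdot> rev_ctx_proj C Y X = entry_proj C Y e"
proof (induction X)
  case (Cons e' X)
  have o: "rev_Prod C X \<in> Obj C" "fst e' \<in> Obj C" "Prod C Y \<in> Obj C" "fst e \<in> Obj C"
    using assms Cons.prems by (auto intro!: rev_Prod_obj Prod_obj)
  have h: "rev_ctx_proj C Y X \<in> Hom C (Prod C Y) (rev_Prod C X)"
      "entry_proj C Y e' \<in> Hom C (Prod C Y) (fst e')"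
    using assms Cons.prems by (auto intro!: rev_ctx_proj_hom entry_proj_hom)
  show ?case
  proof (cases "e = e'")
    case True
    then show ?thesis
      using prj2_pairing[OF o(1,2,3) h] by simp
  next
    case False
    then have e: "e \<in> set X"
      using Cons.prems by simp
    then have "rev_entry_proj C X e \<in> Hom C (rev_Prod C X) (fst e)"
      using assms Cons.prems by (intro rev_entry_proj_hom) auto
    from cmp_assoc[OF o(3) prd_obj[OF o(1,2)] o(1,4) pairing_hom[OF o(1,2,3) h] prj1_hom[OF o(1,2)] this]
    show ?thesis
      using False e Cons prj1_pairing[OF o(1,2,3) h] by simp
  qed
qed simp

lemma entry_proj_ctx_proj:
  "\<lbrakk>fst ` set Y \<subseteq> Obj C; set X \<subseteq> set Y; e \<in> set X\<rbrakk>
    \<Longrightarrow> entry_proj C X e \<cdot> ctx_proj C Y X = entry_proj C Y e"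
  using rev_entry_proj_ctx_proj[of Y "rev X"] by (simp add: entry_proj_def ctx_proj_def)

text \<open>Functoriality of the projections, which makes the products \<open>Prod C X\<close> an
  inverse system over the lists of constants. The empty list is settled by terminality, each further
  entry by composing into a pairing.\<close>

lemma rev_ctx_proj_cmp:
  assumes "fst ` set Z \<subseteq> Obj C" "set Y \<subseteq> set Z"
  shows "set X \<subseteq> set Y \<Longrightarrow> rev_ctx_proj C Y X \<cdot> ctx_proj C Z Y = rev_ctx_proj C Z X"
proof (induction X)
  case Nil
  have "Prod C Y \<in> Obj C" "Prod C Z \<in> Obj C" "ctx_proj C Z Y \<in> Hom C (Prod C Z) (Prod C Y)"
    using assms by (auto intro!: Prod_obj ctx_proj_hom)
  then show ?case
    using cmp_hom[OF _ _ trm_obj _ bang_hom] by (auto intro!: trm_unique[of "Prod C Z"] bang_hom)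
next
  case (Cons e X)
  have Y: "fst ` set Y \<subseteq> Obj C"
    using assms by auto
  then have X: "fst ` set X \<subseteq> Obj C" "fst e \<in> Obj C"
    using Cons.prems by auto
  have "pairing C (Prod C Y) (rev_Prod C X) (fst e) (rev_ctx_proj C Y X) (entry_proj C Y e) \<cdot> ctx_proj C Z Y
      = pairing C (Prod C Z) (rev_Prod C X) (fst e)
          (rev_ctx_proj C Y X \<cdot> ctx_proj C Z Y) (entry_proj C Y e \<cdot> ctx_proj C Z Y)"
    using assms X Y Cons.prems
    by (intro pairing_cmp) (auto intro!: Prod_obj rev_Prod_obj ctx_proj_hom rev_ctx_proj_hom entry_proj_hom)
  then show ?case
    using assms Cons by (simp add: entry_proj_ctx_proj)
qed

lemma ctx_proj_cmp:
  "\<lbrakk>fst ` set Z \<subseteq> Obj C; set Y \<subseteq> set Z; set X \<subseteq> set Y\<rbrakk>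
    \<Longrightarrow> ctx_proj C Y X \<cdot> ctx_proj C Z Y = ctx_proj C Z X"
  using rev_ctx_proj_cmp[of Z Y "rev X"] by (simp add: ctx_proj_def)

text \<open>An entry other than the last one is reached only after composing with the first
  projection. As \<open>(B, d)\<close> is not among the entries of \<open>X\<close>, every component
  acquires this same factor.\<close>

lemma rev_ctx_proj_snoc_fresh:
  assumes "fst ` set Z \<subseteq> Obj C" "B \<in> Obj C"
  shows "\<lbrakk>set X \<subseteq> set Z; (B, d) \<notin> set X\<rbrakk>
    \<Longrightarrow> rev_ctx_proj C (Z @ [(B, d)]) X = rev_ctx_proj C Z X \<cdot> Prj1 C (Prod C Z) B"
proof (induction X)
  case Nil
  have "Prod C Z \<in> Obj C"
    using assms by (auto intro!: Prod_obj)
  then show ?case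
    using assms cmp_hom[OF prd_obj _ trm_obj prj1_hom bang_hom]
    by (auto intro!: trm_unique[of "Prod C Z \<Otimes> B"] bang_hom prd_obj)
next
  case (Cons e X)
  have o: "Prod C Z \<in> Obj C" "rev_Prod C X \<in> Obj C" "fst e \<in> Obj C"
    using assms Cons.prems by (auto intro!: Prod_obj rev_Prod_obj)
  have "entry_proj C (Z @ [(B, d)]) e = entry_proj C Z e \<cdot> Prj1 C (Prod C Z) B"
    using Cons.prems by (auto simp: entry_proj_def Prod_def)
  then show ?case
    using assms Cons o
    by (simp add: pairing_cmp[OF o(2,3,1) prd_obj] rev_ctx_proj_hom entry_proj_hom prj1_hom)
qed

lemma ctx_proj_snoc_fresh:
  "\<lbrakk>fst ` set Z \<subseteq> Obj C; B \<in> Obj C; set X \<subseteq> set Z; (B, d) \<notin> set X\<rbrakk>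
    \<Longrightarrow> ctx_proj C (Z @ [(B, d)]) X = ctx_proj C Z X \<cdot> Prj1 C (Prod C Z) B"
  using rev_ctx_proj_snoc_fresh[of Z B "rev X"] by (simp add: ctx_proj_def)

text \<open>This brings the projection into the shape, an arrow times the identity of
  \<open>B\<close>, in which Beck-Chevalley is stated. The fresh constant is last on both sides and
  stays untouched, while the other components factor through the first projection.\<close>

lemma ctx_proj_snoc_snoc:
  assumes "fst ` set Z \<subseteq> Obj C" "B \<in> Obj C" "set X \<subseteq> set Z" "(B, d) \<notin> set X"
  shows "ctx_proj C (Z @ [(B, d)]) (X @ [(B, d)]) = times_id C (Prod C Z) (Prod C X) B (ctx_proj C Z X)"
proof -
  have "ctx_proj C (Z @ [(B, d)]) (X @ [(B, d)]) = pairing C (Prod C Z \<Otimes> B) (Prod C X) B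
      (ctx_proj C (Z @ [(B, d)]) X) (entry_proj C (Z @ [(B, d)]) (B, d))"
    by (simp add: ctx_proj_def Prod_def)
  also have "entry_proj C (Z @ [(B, d)]) (B, d) = Prj2 C (Prod C Z) B"
    by (simp add: entry_proj_def Prod_def)
  finally show ?thesis
    by (simp add: ctx_proj_snoc_fresh[OF assms] times_id_def)
qed

lemma wk_hom:
  "\<lbrakk>fst ` set Y \<subseteq> Obj C; set X \<subseteq> set Y; A \<in> Obj C\<rbrakk>
    \<Longrightarrow> wk C Y X A \<in> Hom C (Prod C Y \<Otimes> A) (Prod C X \<Otimes> A)"
  unfolding wk_def by (auto intro!: times_id_hom Prod_obj ctx_proj_hom)

lemma wk_cmp:
  "\<lbrakk>fst ` set Z \<subseteq> Obj C; set Y \<subseteq> set Z; set X \<subseteq> set Y; A \<in> Obj C\<rbrakk>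
    \<Longrightarrow> wk C Y X A \<cdot> wk C Z Y A = wk C Z X A"
  unfolding wk_def
  by (subst times_id_cmp) (auto intro!: Prod_obj ctx_proj_hom simp: ctx_proj_cmp)

text \<open>The preorder on lists sees only their entries, so any enumeration of a union is an upper
  bound; this is the source of directedness.\<close>

lemma ctxs_common:
  assumes "finite S" "S \<subseteq> Obj C \<times> Field r"
  obtains Z where "Z \<in> ctxs C r" "set Z = S"
  using finite_distinct_list[OF assms(1)] assms(2) unfolding ctxs_def by auto

lemma ctxs_objD: "X \<in> ctxs C r \<Longrightarrow> fst ` set X \<subseteq> Obj C"
  unfolding ctxs_def by auto

text \<open>The second components land in the terminal object and agree automatically.\<close>

lemma prod_trm_ext:
  assumes "X \<in> Obj C" "Y \<in> Obj C" "h \<in> Hom C X (Y \<Otimes> Trm C)" "k \<in> Hom C X (Y \<Otimes> Trm C)"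
    and "Prj1 C Y (Trm C) \<cdot> h = Prj1 C Y (Trm C) \<cdot> k"
  shows "h = k"
  using cmp_hom[OF assms(1) prd_obj trm_obj _ prj2_hom] assms trm_obj
  by (intro prd_ext[OF assms(2) trm_obj assms(1,3,4,5)] trm_unique[OF assms(1)]) auto

end

section \<open>Fibers of the doctrine with constants\<close>

lemma (in lower_semilattice) le_meet_iff:
  "\<lbrakk>x \<in> carrier L; y \<in> carrier L; z \<in> carrier L\<rbrakk> \<Longrightarrow> z \<sqsubseteq> x \<sqinter> y \<longleftrightarrow> z \<sqsubseteq> x \<and> z \<sqsubseteq> y"
  by (meson le_trans meet_closed meet_le meet_left meet_right)

sublocale doctrine \<subseteq> cat: fp_category "Base D"
  by (rule base)

context doctrine
begin

lemma rdx_mem: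
  "\<lbrakk>A \<in> Obj (Base D); B \<in> Obj (Base D); f \<in> Hom (Base D) A B; \<alpha> \<in> carrier (Fib D B)\<rbrakk>
    \<Longrightarrow> Rdx D f \<alpha> \<in> carrier (Fib D A)"
  using rdx_closed by blast

lemma rdx_le:
  "\<lbrakk>A \<in> Obj (Base D); B \<in> Obj (Base D); f \<in> Hom (Base D) A B;
    \<alpha> \<in> carrier (Fib D B); \<beta> \<in> carrier (Fib D B); \<alpha> \<sqsubseteq>\<^bsub>Fib D B\<^esub> \<beta>\<rbrakk>
    \<Longrightarrow> Rdx D f \<alpha> \<sqsubseteq>\<^bsub>Fib D A\<^esub> Rdx D f \<beta>"
  using rdx_mono unfolding isotone_def by blast

end

locale doctrine_with_constants = primary_doctrine D
  for D :: "('o, 'a, 'p) doctrine_data" + fixes r :: "'l rel"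
begin

abbreviation J :: "('o \<times> 'l) list set" where
  "J \<equiv> ctxs (Base D) r"

abbreviation over :: "('o \<times> 'l) list \<Rightarrow> 'o \<Rightarrow> 'p gorder" where
  "over X A \<equiv> Fib D (Prod (Base D) X \<Otimes>\<^bsub>Base D\<^esub> A)"

abbreviation weaken :: "('o \<times> 'l) list \<Rightarrow> ('o \<times> 'l) list \<Rightarrow> 'o \<Rightarrow> 'p \<Rightarrow> 'p" where
  "weaken Z X A \<equiv> Rdx D (wk (Base D) Z X A)"

text \<open>The presentations of elements before passing to the quotient: \<open>elt_rel\<close> is
  an equivalence on this set and \<open>uelt\<close> is the quotient map.\<close>

definition pres :: "'o \<Rightarrow> ('p \<times> ('o \<times> 'l) list) set" where
  "pres A = {(\<alpha>, X). X \<in> J \<and> \<alpha> \<in> carrier (over X A)}"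

lemma pres_iff [simp]: "(\<alpha>, X) \<in> pres A \<longleftrightarrow> X \<in> J \<and> \<alpha> \<in> carrier (over X A)"
  by (simp add: pres_def)

lemma over_obj: "\<lbrakk>X \<in> J; A \<in> Obj (Base D)\<rbrakk> \<Longrightarrow> Prod (Base D) X \<Otimes>\<^bsub>Base D\<^esub> A \<in> Obj (Base D)"
  by (intro cat.prd_obj cat.Prod_obj cat.ctxs_objD)

lemma wk_hom:
  "\<lbrakk>Z \<in> J; set X \<subseteq> set Z; A \<in> Obj (Base D)\<rbrakk>
    \<Longrightarrow> wk (Base D) Z X A \<in> Hom (Base D) (Prod (Base D) Z \<Otimes>\<^bsub>Base D\<^esub> A) (Prod (Base D) X \<Otimes>\<^bsub>Base D\<^esub> A)"
  by (intro cat.wk_hom cat.ctxs_objD)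

lemma ctxs_join:
  assumes "X \<in> J" "Y \<in> J"
  obtains Z where "Z \<in> J" "set Z = set X \<union> set Y"
  using cat.ctxs_common[of "set X \<union> set Y" r] assms unfolding ctxs_def by auto

lemma weaken_closed:
  "\<lbrakk>A \<in> Obj (Base D); (\<alpha>, X) \<in> pres A; Z \<in> J; set X \<subseteq> set Z\<rbrakk> \<Longrightarrow> weaken Z X A \<alpha> \<in> carrier (over Z A)"
  by (auto intro!: rdx_mem[OF _ _ wk_hom] over_obj)

lemma weaken_weaken:
  assumes "A \<in> Obj (Base D)" "(\<alpha>, X) \<in> pres A" "Y \<in> J" "Z \<in> J" "set X \<subseteq> set Y" "set Y \<subseteq> set Z"
  shows "weaken Z Y A (weaken Y X A \<alpha>) = weaken Z X A \<alpha>"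
proof -
  have "X \<in> J" "\<alpha> \<in> carrier (over X A)"
    using assms(2) by auto
  from rdx_cmp[OF over_obj[OF assms(4,1)] over_obj[OF assms(3,1)] over_obj[OF this(1) assms(1)]
      wk_hom[OF assms(4,6,1)] wk_hom[OF assms(3,5,1)] this(2)]
  show ?thesis
    by (simp add: cat.wk_cmp[OF cat.ctxs_objD[OF assms(4)] assms(6,5,1)])
qed

text \<open>Inequalities persist at larger lists because reindexing is monotone and functorial.
  Facts found at unrelated lists can therefore be compared at a join.\<close>

lemma weaken_le:
  assumes "A \<in> Obj (Base D)" "(\<alpha>, X) \<in> pres A" "(\<beta>, Y) \<in> pres A" "Z \<in> J" "Z' \<in> J"
    and "set X \<subseteq> set Z" "set Y \<subseteq> set Z" "set Z \<subseteq> set Z'"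
    and "weaken Z X A \<alpha> \<sqsubseteq>\<^bsub>over Z A\<^esub> weaken Z Y A \<beta>"
  shows "weaken Z' X A \<alpha> \<sqsubseteq>\<^bsub>over Z' A\<^esub> weaken Z' Y A \<beta>"
  using rdx_le[OF over_obj[OF assms(5,1)] over_obj[OF assms(4,1)] wk_hom[OF assms(5,8,1)]
      weaken_closed[OF assms(1,2,4,6)] weaken_closed[OF assms(1,3,4,7)] assms(9)]
    weaken_weaken[OF assms(1,2,4,5,6,8)] weaken_weaken[OF assms(1,3,4,5,7,8)]
  by simp

lemma elt_rel_iff:
  "((\<alpha>, X), (\<beta>, Y)) \<in> elt_rel D r A \<longleftrightarrow> (\<alpha>, X) \<in> pres A \<and> (\<beta>, Y) \<in> pres A \<and>
    (\<exists>Z \<in> J. set X \<union> set Y \<subseteq> set Z \<and> weaken Z X A \<alpha> = weaken Z Y A \<beta>)"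
  unfolding elt_rel_def by auto

lemma elt_relE:
  assumes "((\<alpha>, X), (\<beta>, Y)) \<in> elt_rel D r A"
  obtains Z where "(\<alpha>, X) \<in> pres A" "(\<beta>, Y) \<in> pres A" "Z \<in> J" "set X \<subseteq> set Z" "set Y \<subseteq> set Z"
    "weaken Z X A \<alpha> = weaken Z Y A \<beta>"
  using assms unfolding elt_rel_iff by blast

lemma weaken_eq:
  assumes "A \<in> Obj (Base D)" "(\<alpha>, X) \<in> pres A" "(\<beta>, Y) \<in> pres A" "Z \<in> J" "Z' \<in> J"
    and "set X \<subseteq> set Z" "set Y \<subseteq> set Z" "set Z \<subseteq> set Z'"
    and "weaken Z X A \<alpha> = weaken Z Y A \<beta>"
  shows "weaken Z' X A \<alpha> = weaken Z' Y A \<beta>"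
  using weaken_weaken[OF assms(1,2,4,5,6,8)] weaken_weaken[OF assms(1,3,4,5,7,8)] assms(9) by simp

lemma equiv_elt_rel:
  assumes "A \<in> Obj (Base D)"
  shows "equiv (pres A) (elt_rel D r A)"
proof (rule equivI)
  show "elt_rel D r A \<subseteq> pres A \<times> pres A"
    by (auto simp: elt_rel_def)
  show "refl_on (pres A) (elt_rel D r A)"
    by (auto simp: refl_on_def elt_rel_def)
  show "sym (elt_rel D r A)"
  proof (rule symI, clarify)
    fix \<alpha> X \<beta> Y
    assume "((\<alpha>, X), (\<beta>, Y)) \<in> elt_rel D r A"
    then show "((\<beta>, Y), (\<alpha>, X)) \<in> elt_rel D r A"
      unfolding elt_rel_iff by (metis Un_commute)
  qed
  show "trans (elt_rel D r A)"
  proof (rule transI, clarify)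
    fix \<alpha> X \<beta> Y \<gamma> V
    assume e: "((\<alpha>, X), (\<beta>, Y)) \<in> elt_rel D r A" "((\<beta>, Y), (\<gamma>, V)) \<in> elt_rel D r A"
    obtain Z1 where p: "(\<alpha>, X) \<in> pres A" "(\<beta>, Y) \<in> pres A"
      and Z1: "Z1 \<in> J" "set X \<subseteq> set Z1" "set Y \<subseteq> set Z1" "weaken Z1 X A \<alpha> = weaken Z1 Y A \<beta>"
      using e(1) by (rule elt_relE)
    obtain Z2 where p': "(\<gamma>, V) \<in> pres A"
      and Z2: "Z2 \<in> J" "set Y \<subseteq> set Z2" "set V \<subseteq> set Z2" "weaken Z2 Y A \<beta> = weaken Z2 V A \<gamma>"
      using e(2) by (rule elt_relE)
    \<comment> \<open>The two equalities are witnessed at unrelated lists; both persist at a common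
      upper bound, where they can be chained.\<close>
    obtain Z where Z: "Z \<in> J" "set Z = set Z1 \<union> set Z2"
      using Z1(1) Z2(1) by (rule ctxs_join)
    have "weaken Z X A \<alpha> = weaken Z Y A \<beta>"
      using weaken_eq[OF assms p(1,2) Z1(1) Z(1) Z1(2,3) _ Z1(4)] Z(2) by simp
    also have "\<dots> = weaken Z V A \<gamma>"
      using weaken_eq[OF assms p(2) p' Z2(1) Z(1) Z2(2,3) _ Z2(4)] Z(2) by simp
    finally show "((\<alpha>, X), (\<gamma>, V)) \<in> elt_rel D r A"
      using p p' Z Z1(2) Z2(3) by (auto simp: elt_rel_iff)
  qed
qed

lemma ufib_carrier: "p \<in> carrier (ufib D r A) \<longleftrightarrow> (\<exists>\<alpha> X. (\<alpha>, X) \<in> pres A \<and> p = uelt D r A \<alpha> X)"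
  by (auto simp: ufib_def)

lemma uelt_closed: "(\<alpha>, X) \<in> pres A \<Longrightarrow> uelt D r A \<alpha> X \<in> carrier (ufib D r A)"
  by (auto simp: ufib_carrier)

lemma uelt_self:
  "\<lbrakk>A \<in> Obj (Base D); (\<alpha>, X) \<in> pres A\<rbrakk> \<Longrightarrow> (\<alpha>, X) \<in> uelt D r A \<alpha> X"
  unfolding uelt_def by (rule equiv_class_self[OF equiv_elt_rel])

lemma uelt_eq_iff:
  assumes "A \<in> Obj (Base D)" "(\<alpha>, X) \<in> pres A" "(\<beta>, Y) \<in> pres A"
  shows "uelt D r A \<alpha> X = uelt D r A \<beta> Y \<longleftrightarrow> ((\<alpha>, X), (\<beta>, Y)) \<in> elt_rel D r A"
  unfolding uelt_def using eq_equiv_class_iff[OF equiv_elt_rel[OF assms(1)] assms(2,3)] by simp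

lemma mem_uelt_iff:
  "\<lbrakk>A \<in> Obj (Base D); (\<alpha>, X) \<in> pres A\<rbrakk>
    \<Longrightarrow> (\<beta>, Y) \<in> uelt D r A \<alpha> X \<longleftrightarrow> (\<beta>, Y) \<in> pres A \<and> uelt D r A \<beta> Y = uelt D r A \<alpha> X"
  using uelt_eq_iff[of A \<alpha> X \<beta> Y] unfolding uelt_def by (auto simp: elt_rel_iff)

text \<open>The list \<open>Z\<close> itself is a stage of agreement: a further reindexing from
  \<open>Z\<close> to \<open>Z\<close> is absorbed by \<open>weaken_weaken\<close>.\<close>

lemma uelt_weaken:
  assumes "A \<in> Obj (Base D)" "(\<alpha>, X) \<in> pres A" "Z \<in> J" "set X \<subseteq> set Z"
  shows "uelt D r A (weaken Z X A \<alpha>) Z = uelt D r A \<alpha> X"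
proof -
  have "(weaken Z X A \<alpha>, Z) \<in> pres A"
    using weaken_closed[OF assms] assms(3) by simp
  then show ?thesis
    using assms weaken_weaken[OF assms(1,2,3,3,4)]
    by (subst uelt_eq_iff[OF assms(1)]) (auto simp: elt_rel_iff intro!: bexI[of _ Z])
qed

text \<open>The order of \<open>ufib\<close> lets both presentations vary. A change of presentation
  is an equality at some list, so above these lists and the list of the given inequality everything
  can be rewritten in terms of the chosen presentations.\<close>

lemma uelt_le_iff:
  assumes A: "A \<in> Obj (Base D)" and p: "(\<alpha>, X) \<in> pres A" "(\<beta>, Y) \<in> pres A"
  shows "uelt D r A \<alpha> X \<sqsubseteq>\<^bsub>ufib D r A\<^esub> uelt D r A \<beta> Y \<longleftrightarrow>
    (\<exists>Z \<in> J. set X \<union> set Y \<subseteq> set Z \<and> weaken Z X A \<alpha> \<sqsubseteq>\<^bsub>over Z A\<^esub> weaken Z Y A \<beta>)"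
    (is "?le \<longleftrightarrow> ?ex")
proof
  assume ?ex
  then have "\<exists>(\<alpha>', X') \<in> uelt D r A \<alpha> X. \<exists>(\<beta>', Y') \<in> uelt D r A \<beta> Y.
      \<exists>Z \<in> J. set X' \<union> set Y' \<subseteq> set Z \<and> weaken Z X' A \<alpha>' \<sqsubseteq>\<^bsub>over Z A\<^esub> weaken Z Y' A \<beta>'"
    by (intro bexI[OF _ uelt_self[OF A p(1)]] case_prodI bexI[OF _ uelt_self[OF A p(2)]])
  then show ?le
    by (simp add: ufib_def)
next
  assume ?le
  then obtain \<alpha>' X' \<beta>' Y' Z0 where m: "(\<alpha>', X') \<in> uelt D r A \<alpha> X" "(\<beta>', Y') \<in> uelt D r A \<beta> Y"
    and Z0: "Z0 \<in> J" "set X' \<subseteq> set Z0" "set Y' \<subseteq> set Z0"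
      "weaken Z0 X' A \<alpha>' \<sqsubseteq>\<^bsub>over Z0 A\<^esub> weaken Z0 Y' A \<beta>'"
    by (auto simp: ufib_def)
  obtain Z1 where p': "(\<alpha>', X') \<in> pres A"
    and Z1: "Z1 \<in> J" "set X \<subseteq> set Z1" "set X' \<subseteq> set Z1" "weaken Z1 X A \<alpha> = weaken Z1 X' A \<alpha>'"
    using m(1) unfolding uelt_def Image_singleton_iff by (rule elt_relE)
  obtain Z2 where q': "(\<beta>', Y') \<in> pres A"
    and Z2: "Z2 \<in> J" "set Y \<subseteq> set Z2" "set Y' \<subseteq> set Z2" "weaken Z2 Y A \<beta> = weaken Z2 Y' A \<beta>'"
    using m(2) unfolding uelt_def Image_singleton_iff by (rule elt_relE)
  obtain Z3 where Z3: "Z3 \<in> J" "set Z3 = set Z1 \<union> set Z2"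
    using Z1(1) Z2(1) by (rule ctxs_join)
  obtain Z where Z: "Z \<in> J" "set Z = set Z0 \<union> set Z3"
    using Z0(1) Z3(1) by (rule ctxs_join)
  have s: "set Z0 \<subseteq> set Z" "set Z1 \<subseteq> set Z" "set Z2 \<subseteq> set Z"
    using Z(2) Z3(2) by auto
  have "weaken Z X A \<alpha> \<sqsubseteq>\<^bsub>over Z A\<^esub> weaken Z Y A \<beta>"
    using weaken_eq[OF A p(1) p' Z1(1) Z(1) Z1(2,3) s(2) Z1(4)] weaken_eq[OF A p(2) q' Z2(1) Z(1) Z2(2,3) s(3) Z2(4)]
      weaken_le[OF A p' q' Z0(1) Z(1) Z0(2,3) s(1) Z0(4)]
    by simp
  then show ?ex
    using Z(1) s Z1(2) Z2(2) by (intro bexI[of _ Z]) auto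
qed

lemma uelt_le_same:
  assumes "A \<in> Obj (Base D)" "(\<alpha>, X) \<in> pres A" "(\<beta>, X) \<in> pres A" "\<alpha> \<sqsubseteq>\<^bsub>over X A\<^esub> \<beta>"
  shows "uelt D r A \<alpha> X \<sqsubseteq>\<^bsub>ufib D r A\<^esub> uelt D r A \<beta> X"
proof -
  have "X \<in> J" "\<alpha> \<in> carrier (over X A)" "\<beta> \<in> carrier (over X A)"
    using assms by auto
  then show ?thesis
    using assms by (subst uelt_le_iff) (auto intro!: bexI[of _ X] rdx_le[OF _ _ wk_hom] over_obj)
qed

lemma common_ctx:
  assumes "A \<in> Obj (Base D)" "p \<in> carrier (ufib D r A)" "q \<in> carrier (ufib D r A)"
  obtains \<alpha> \<beta> Z where "(\<alpha>, Z) \<in> pres A" "(\<beta>, Z) \<in> pres A" "p = uelt D r A \<alpha> Z" "q = uelt D r A \<beta> Z"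
proof -
  obtain \<alpha> X \<beta> Y where p: "(\<alpha>, X) \<in> pres A" "p = uelt D r A \<alpha> X"
    and q: "(\<beta>, Y) \<in> pres A" "q = uelt D r A \<beta> Y"
    using assms(2,3) unfolding ufib_carrier by (elim exE conjE)
  then have "X \<in> J" "Y \<in> J"
    by simp_all
  then obtain Z where "Z \<in> J" "set Z = set X \<union> set Y"
    by (rule ctxs_join)
  then have Z: "Z \<in> J" "set X \<subseteq> set Z" "set Y \<subseteq> set Z"
    by simp_all
  show thesis
  proof (rule that)
    show "(weaken Z X A \<alpha>, Z) \<in> pres A" "(weaken Z Y A \<beta>, Z) \<in> pres A"
      using weaken_closed[OF assms(1) p(1) Z(1,2)] weaken_closed[OF assms(1) q(1) Z(1,3)] Z(1) by simp_all
    show "p = uelt D r A (weaken Z X A \<alpha>) Z" "q = uelt D r A (weaken Z Y A \<beta>) Z"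
      using uelt_weaken[OF assms(1) p(1) Z(1,2)] uelt_weaken[OF assms(1) q(1) Z(1,3)] p(2) q(2) by simp_all
  qed
qed

text \<open>Each law is inherited from one fiber of the original doctrine, over a list large enough
  for all inequalities involved. Antisymmetry there equates only the weakened formulas, which is
  precisely equality of the classes.\<close>

lemma partial_order_ufib:
  assumes A: "A \<in> Obj (Base D)"
  shows "partial_order (ufib D r A)"
proof -
  have eq [simp]: "(.=\<^bsub>ufib D r A\<^esub>) = (=)"
    by (simp add: ufib_def)
  have refl: "p \<sqsubseteq>\<^bsub>ufib D r A\<^esub> p" if c: "p \<in> carrier (ufib D r A)" for p
  proof -
    obtain \<alpha> X where p: "(\<alpha>, X) \<in> pres A" "p = uelt D r A \<alpha> X"
      using c unfolding ufib_carrier by blast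
    then interpret po: partial_order "over X A"
      using A by (auto intro!: fib_order over_obj)
    show ?thesis
      using A p by (auto intro!: uelt_le_same)
  qed
  have antisym: "p = q" if "p \<sqsubseteq>\<^bsub>ufib D r A\<^esub> q" "q \<sqsubseteq>\<^bsub>ufib D r A\<^esub> p"
    and c: "p \<in> carrier (ufib D r A)" "q \<in> carrier (ufib D r A)" for p q
  proof -
    obtain \<alpha> \<beta> X where p: "(\<alpha>, X) \<in> pres A" and q: "(\<beta>, X) \<in> pres A"
      and [simp]: "p = uelt D r A \<alpha> X" "q = uelt D r A \<beta> X"
      by (rule common_ctx[OF A c])
    from that obtain Z1 Z2 where Z1: "Z1 \<in> J" "set X \<subseteq> set Z1" "weaken Z1 X A \<alpha> \<sqsubseteq>\<^bsub>over Z1 A\<^esub> weaken Z1 X A \<beta>"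
      and Z2: "Z2 \<in> J" "set X \<subseteq> set Z2" "weaken Z2 X A \<beta> \<sqsubseteq>\<^bsub>over Z2 A\<^esub> weaken Z2 X A \<alpha>"
      by (auto simp: uelt_le_iff[OF A p q] uelt_le_iff[OF A q p])
    obtain Z where Z: "Z \<in> J" "set Z = set Z1 \<union> set Z2"
      using Z1(1) Z2(1) by (rule ctxs_join)
    interpret po: partial_order "over Z A"
      using A Z by (auto intro!: fib_order over_obj)
    have X: "set X \<subseteq> set Z" "set Z1 \<subseteq> set Z" "set Z2 \<subseteq> set Z"
      using Z Z1 by auto
    have "weaken Z X A \<alpha> = weaken Z X A \<beta>"
      using weaken_le[OF A p q Z1(1) Z(1) Z1(2,2) X(2) Z1(3)] weaken_le[OF A q p Z2(1) Z(1) Z2(2,2) X(3) Z2(3)]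
        weaken_closed[OF A p Z(1) X(1)] weaken_closed[OF A q Z(1) X(1)]
      by (rule po.le_antisym)
    then show ?thesis
      using A p q Z X by (auto simp: uelt_eq_iff[OF A p q] elt_rel_iff)
  qed
  have trans: "p \<sqsubseteq>\<^bsub>ufib D r A\<^esub> s" if "p \<sqsubseteq>\<^bsub>ufib D r A\<^esub> q" "q \<sqsubseteq>\<^bsub>ufib D r A\<^esub> s"
    and c: "p \<in> carrier (ufib D r A)" "q \<in> carrier (ufib D r A)" "s \<in> carrier (ufib D r A)" for p q s
  proof -
    obtain \<alpha> \<beta> X where p: "(\<alpha>, X) \<in> pres A" and q: "(\<beta>, X) \<in> pres A"
      and [simp]: "p = uelt D r A \<alpha> X" "q = uelt D r A \<beta> X"
      by (rule common_ctx[OF A c(1,2)])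
    obtain \<gamma> Y where s: "(\<gamma>, Y) \<in> pres A" and [simp]: "s = uelt D r A \<gamma> Y"
      using c(3) unfolding ufib_carrier by blast
    from that obtain Z1 Z2 where Z1: "Z1 \<in> J" "set X \<subseteq> set Z1" "weaken Z1 X A \<alpha> \<sqsubseteq>\<^bsub>over Z1 A\<^esub> weaken Z1 X A \<beta>"
      and Z2: "Z2 \<in> J" "set X \<subseteq> set Z2" "set Y \<subseteq> set Z2" "weaken Z2 X A \<beta> \<sqsubseteq>\<^bsub>over Z2 A\<^esub> weaken Z2 Y A \<gamma>"
      by (auto simp: uelt_le_iff[OF A p q] uelt_le_iff[OF A q s])
    obtain Z where Z: "Z \<in> J" "set Z = set Z1 \<union> set Z2"
      using Z1(1) Z2(1) by (rule ctxs_join)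
    interpret po: partial_order "over Z A"
      using A Z by (auto intro!: fib_order over_obj)
    have X: "set X \<subseteq> set Z" "set Y \<subseteq> set Z" "set Z1 \<subseteq> set Z" "set Z2 \<subseteq> set Z"
      using Z Z1 Z2 by auto
    have "weaken Z X A \<alpha> \<sqsubseteq>\<^bsub>over Z A\<^esub> weaken Z Y A \<gamma>"
      using weaken_le[OF A p q Z1(1) Z(1) Z1(2,2) X(3) Z1(3)] weaken_le[OF A q s Z2(1) Z(1) Z2(2,3) X(4) Z2(4)]
        weaken_closed[OF A p Z(1) X(1)] weaken_closed[OF A q Z(1) X(1)] weaken_closed[OF A s Z(1) X(2)]
      by (rule po.le_trans)
    then show ?thesis
      using Z X by (auto simp: uelt_le_iff[OF A p s])
  qed
  show ?thesis
  proof unfold_locales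
    show "x \<sqsubseteq>\<^bsub>ufib D r A\<^esub> z" if "x \<sqsubseteq>\<^bsub>ufib D r A\<^esub> y" "y \<sqsubseteq>\<^bsub>ufib D r A\<^esub> z"
      "x \<in> carrier (ufib D r A)" "y \<in> carrier (ufib D r A)" "z \<in> carrier (ufib D r A)" for x y z
      using that by (rule trans)
    show "x .=\<^bsub>ufib D r A\<^esub> y" if "x \<sqsubseteq>\<^bsub>ufib D r A\<^esub> y" "y \<sqsubseteq>\<^bsub>ufib D r A\<^esub> x"
      "x \<in> carrier (ufib D r A)" "y \<in> carrier (ufib D r A)" for x y
      using antisym[OF that] by simp
  qed (simp_all add: refl)
qed

text \<open>A lower bound may be presented over a list unrelated to \<open>X\<close>, so the
  universal property at \<open>X\<close> does not suffice. Its two inequalities are moved to a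
  common list, where preservation of meets by reindexing identifies the meet with the weakened
  one.\<close>

lemma greatest_uelt_meet:
  assumes A: "A \<in> Obj (Base D)" and p: "(\<alpha>, X) \<in> pres A" "(\<beta>, X) \<in> pres A"
  shows "greatest (ufib D r A) (uelt D r A (\<alpha> \<sqinter>\<^bsub>over X A\<^esub> \<beta>) X)
    (Lower (ufib D r A) {uelt D r A \<alpha> X, uelt D r A \<beta> X})"
proof -
  interpret u: partial_order "ufib D r A"
    by (rule partial_order_ufib[OF A])
  have X: "X \<in> J" and c: "\<alpha> \<in> carrier (over X A)" "\<beta> \<in> carrier (over X A)"
    using p by auto
  interpret o: lower_semilattice "over X A"
    using A X by (auto intro!: fib_meets over_obj)
  have m: "(\<alpha> \<sqinter>\<^bsub>over X A\<^esub> \<beta>, X) \<in> pres A"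
    using c X by simp
  show ?thesis
  proof (rule greatest_LowerI)
    show "uelt D r A (\<alpha> \<sqinter>\<^bsub>over X A\<^esub> \<beta>) X \<sqsubseteq>\<^bsub>ufib D r A\<^esub> x" if "x \<in> {uelt D r A \<alpha> X, uelt D r A \<beta> X}" for x
      using that uelt_le_same[OF A m p(1)] uelt_le_same[OF A m p(2)] o.meet_left[OF c] o.meet_right[OF c] by auto
    show "y \<sqsubseteq>\<^bsub>ufib D r A\<^esub> uelt D r A (\<alpha> \<sqinter>\<^bsub>over X A\<^esub> \<beta>) X"
      if y: "y \<in> Lower (ufib D r A) {uelt D r A \<alpha> X, uelt D r A \<beta> X}" for y
    proof -
      have "y \<in> carrier (ufib D r A)" and le: "y \<sqsubseteq>\<^bsub>ufib D r A\<^esub> uelt D r A \<alpha> X" "y \<sqsubseteq>\<^bsub>ufib D r A\<^esub> uelt D r A \<beta> X"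
        using y uelt_closed[OF p(1)] uelt_closed[OF p(2)] unfolding Lower_def by auto
      then obtain \<gamma> Y where g: "(\<gamma>, Y) \<in> pres A" and [simp]: "y = uelt D r A \<gamma> Y"
        unfolding ufib_carrier by blast
      obtain Z1 Z2 where Z1: "Z1 \<in> J" "set Y \<subseteq> set Z1" "set X \<subseteq> set Z1" "weaken Z1 Y A \<gamma> \<sqsubseteq>\<^bsub>over Z1 A\<^esub> weaken Z1 X A \<alpha>"
        and Z2: "Z2 \<in> J" "set Y \<subseteq> set Z2" "set X \<subseteq> set Z2" "weaken Z2 Y A \<gamma> \<sqsubseteq>\<^bsub>over Z2 A\<^esub> weaken Z2 X A \<beta>"
        using le by (auto simp: uelt_le_iff[OF A g p(1)] uelt_le_iff[OF A g p(2)])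
      obtain Z where Z: "Z \<in> J" "set Z = set Z1 \<union> set Z2"
        using Z1(1) Z2(1) by (rule ctxs_join)
      then have s: "set X \<subseteq> set Z" "set Y \<subseteq> set Z" "set Z1 \<subseteq> set Z" "set Z2 \<subseteq> set Z"
        using Z1 Z2 by auto
      interpret z: lower_semilattice "over Z A"
        using A Z by (auto intro!: fib_meets over_obj)
      have "weaken Z Y A \<gamma> \<sqsubseteq>\<^bsub>over Z A\<^esub> weaken Z X A \<alpha> \<sqinter>\<^bsub>over Z A\<^esub> weaken Z X A \<beta>"
        using weaken_le[OF A g p(1) Z1(1) Z(1) Z1(2,3) s(3) Z1(4)] weaken_le[OF A g p(2) Z2(1) Z(1) Z2(2,3) s(4) Z2(4)]
          weaken_closed[OF A p(1) Z(1) s(1)] weaken_closed[OF A p(2) Z(1) s(1)] weaken_closed[OF A g Z(1) s(2)]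
        by (rule z.meet_le)
      also have "\<dots> = weaken Z X A (\<alpha> \<sqinter>\<^bsub>over X A\<^esub> \<beta>)"
        using rdx_meet[OF over_obj[OF Z(1) A] over_obj[OF X A] wk_hom[OF Z(1) s(1) A] c] by simp
      finally show ?thesis
        using Z(1) s by (auto simp: uelt_le_iff[OF A g m])
    qed
  qed (use uelt_closed[OF m] uelt_closed[OF p(1)] uelt_closed[OF p(2)] in auto)
qed

lemma lower_semilattice_ufib:
  assumes A: "A \<in> Obj (Base D)"
  shows "lower_semilattice (ufib D r A)"
proof -
  interpret u: partial_order "ufib D r A"
    by (rule partial_order_ufib[OF A])
  show ?thesis
  proof unfold_locales
    fix p q
    assume c: "p \<in> carrier (ufib D r A)" "q \<in> carrier (ufib D r A)"
    obtain \<alpha> \<beta> Z where "(\<alpha>, Z) \<in> pres A" "(\<beta>, Z) \<in> pres A"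
      "p = uelt D r A \<alpha> Z" "q = uelt D r A \<beta> Z"
      by (rule common_ctx[OF A c])
    then show "\<exists>s. greatest (ufib D r A) s (Lower (ufib D r A) {p, q})"
      using greatest_uelt_meet[OF A] by blast
  qed
qed

lemma uelt_meet:
  assumes A: "A \<in> Obj (Base D)" and p: "(\<alpha>, X) \<in> pres A" "(\<beta>, X) \<in> pres A"
  shows "uelt D r A \<alpha> X \<sqinter>\<^bsub>ufib D r A\<^esub> uelt D r A \<beta> X = uelt D r A (\<alpha> \<sqinter>\<^bsub>over X A\<^esub> \<beta>) X"
proof -
  interpret u: lower_semilattice "ufib D r A"
    by (rule lower_semilattice_ufib[OF A])
  show ?thesis
    using u.inf_of_two_greatest[OF uelt_closed[OF p(1)] uelt_closed[OF p(2)]] greatest_uelt_meet[OF assms]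
    unfolding meet_def by (rule u.greatest_unique)
qed

end

section \<open>The terminal arrow of the category with constants\<close>

context fp_category
begin

text \<open>Weakened to a common list, two representatives become parallel arrows into the terminal
  object, hence equal; so all representatives form a single class.\<close>

lemma arr_rel_Trm_Image:
  assumes "A \<in> Obj C" "X \<in> ctxs C r" "f \<in> Hom C (Prod C X \<Otimes> A) (Trm C)"
  shows "arr_rel C r A (Trm C) `` {(f, X)}
    = {(g, Y). Y \<in> ctxs C r \<and> g \<in> Hom C (Prod C Y \<Otimes> A) (Trm C)}"
proof -
  have "((f, X), (g, Y)) \<in> arr_rel C r A (Trm C)"
    if g: "Y \<in> ctxs C r" "g \<in> Hom C (Prod C Y \<Otimes> A) (Trm C)" for g Y
  proof -
    obtain Z where Z: "Z \<in> ctxs C r" "set Z = set X \<union> set Y"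
      using ctxs_common[of "set X \<union> set Y" r] assms(2) g(1) unfolding ctxs_def by auto
    have o: "Prod C V \<Otimes> A \<in> Obj C" if "V \<in> ctxs C r" for V
      using that assms(1) by (intro prd_obj Prod_obj ctxs_objD)
    have w: "wk C Z X A \<in> Hom C (Prod C Z \<Otimes> A) (Prod C X \<Otimes> A)"
      "wk C Z Y A \<in> Hom C (Prod C Z \<Otimes> A) (Prod C Y \<Otimes> A)"
      using wk_hom[OF ctxs_objD[OF Z(1)] _ assms(1)] Z(2) by auto
    have "f \<cdot> wk C Z X A = g \<cdot> wk C Z Y A"
      using cmp_hom[OF o[OF Z(1)] o[OF assms(2)] trm_obj w(1) assms(3)]
        cmp_hom[OF o[OF Z(1)] o[OF g(1)] trm_obj w(2) g(2)]
      by (rule trm_unique[OF o[OF Z(1)]])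
    then show ?thesis
      using assms g Z unfolding arr_rel_def by auto
  qed
  then show ?thesis
    by (auto simp: arr_rel_def)
qed

text \<open>The class is made explicit because reindexing in \<open>udoc\<close> takes a union over
  all representatives of the arrow.\<close>

lemma bang_ucat:
  assumes "A \<in> Obj C"
  shows "bang (ucat C r) A
    = (A, Trm C, {(g, Y). Y \<in> ctxs C r \<and> g \<in> Hom C (Prod C Y \<Otimes> A) (Trm C)})"
proof -
  have nil: "[] \<in> ctxs C r"
    by (simp add: ctxs_def)
  have "bang C (Trm C \<Otimes> A) \<in> Hom C (Trm C \<Otimes> A) (Trm C)"
    by (rule bang_hom[OF prd_obj[OF trm_obj assms]])
  with nil have mem: "uarr C r A (Trm C) (bang C (Trm C \<Otimes> A)) [] \<in> Hom (ucat C r) A (Trm C)"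
    by (auto simp: ucat_def intro!: exI[of _ "bang C (Trm C \<Otimes> A)"] exI[of _ "[]"])
  define h where
    "h = (A, Trm C, {(g, Y). Y \<in> ctxs C r \<and> g \<in> Hom C (Prod C Y \<Otimes> A) (Trm C)})"
  have "uarr C r A (Trm C) f X = h"
    if "X \<in> ctxs C r" "f \<in> Hom C (Prod C X \<Otimes> A) (Trm C)" for f X
    unfolding uarr_def h_def arr_rel_Trm_Image[OF assms that] ..
  then have "x = h" if "x \<in> Hom (ucat C r) A (Trm C)" for x
    using that by (auto simp: ucat_def)
  with mem have "Hom (ucat C r) A (Trm C) = {h}"
    by blast
  then show ?thesis
    by (simp add: bang_def ucat_def h_def)
qed

lemma graph_of_Trm:
  assumes "Z \<in> ctxs C r" "f \<in> Hom C (Prod C Z \<Otimes> Trm C) (Trm C)"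
  shows "graph_of C Z (Trm C) (Trm C) f = Idn C (Prod C Z \<Otimes> Trm C)"
proof -
  have Z: "Prod C Z \<in> Obj C"
    by (rule Prod_obj[OF ctxs_objD[OF assms(1)]])
  note o = prd_obj[OF Z trm_obj]
  note p = prj1_hom[OF Z trm_obj]
  show ?thesis
    unfolding graph_of_def
    using pairing_hom[OF Z trm_obj o p assms(2)] idn_hom[OF o]
    by (rule prod_trm_ext[OF o Z])
      (simp add: prj1_pairing[OF Z trm_obj o p assms(2)] cmp_idn_right[OF o Z p])
qed

end

context doctrine_with_constants
begin

text \<open>Even over the terminal object, \<open>henkin_at\<close> reindexes the axioms along the
  terminal arrow; this removes that reindexing.\<close>

lemma rdx_bang_udoc:
  assumes "q \<in> carrier (ufib D r (Trm (Base D)))"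
  shows "Rdx (udoc D r) (bang (ucat (Base D) r) (Trm (Base D))) q = q"
proof -
  let ?t = "Trm (Base D)"
  obtain \<alpha> X where p: "(\<alpha>, X) \<in> pres ?t" and q: "q = uelt D r ?t \<alpha> X"
    using assms unfolding ufib_carrier by blast
  \<comment> \<open>Every member of the union is already \<open>q\<close>: the graph arrow is an
    identity, so \<open>\<beta>\<close> is unchanged, and \<open>(\<beta>, Z)\<close> is one of the
    presentations of \<open>q\<close>.\<close>
  have *: "uelt D r ?t (Rdx D (graph_of (Base D) Z ?t ?t f) \<beta>) Z = q"
    if "f \<in> Hom (Base D) (Prod (Base D) Z \<Otimes>\<^bsub>Base D\<^esub> ?t) ?t" "(\<beta>, Z) \<in> q" for f \<beta> Z
    using that(2) mem_uelt_iff[OF cat.trm_obj p] cat.graph_of_Trm[OF _ that(1)]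
      rdx_idn[OF over_obj[OF _ cat.trm_obj]]
    unfolding q by auto
  have X: "X \<in> J" "(\<alpha>, X) \<in> q"
    using p uelt_self[OF cat.trm_obj p] q by auto
  have b: "bang (Base D) (Prod (Base D) X \<Otimes>\<^bsub>Base D\<^esub> ?t)
      \<in> Hom (Base D) (Prod (Base D) X \<Otimes>\<^bsub>Base D\<^esub> ?t) ?t"
    by (rule cat.bang_hom[OF over_obj[OF X(1) cat.trm_obj]])
  have "Rdx (udoc D r) (bang (ucat (Base D) r) ?t) q
      = \<Union> {uelt D r ?t (Rdx D (graph_of (Base D) Z ?t ?t f) \<beta>) Z | f \<beta> Z.
          Z \<in> J \<and> f \<in> Hom (Base D) (Prod (Base D) Z \<Otimes>\<^bsub>Base D\<^esub> ?t) ?t \<and> (\<beta>, Z) \<in> q}"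
    by (simp add: cat.bang_ucat[OF cat.trm_obj] udoc_def conj_assoc)
  also have "{uelt D r ?t (Rdx D (graph_of (Base D) Z ?t ?t f) \<beta>) Z | f \<beta> Z.
      Z \<in> J \<and> f \<in> Hom (Base D) (Prod (Base D) Z \<Otimes>\<^bsub>Base D\<^esub> ?t) ?t \<and> (\<beta>, Z) \<in> q} = {q}"
    (is "?S = _")
  proof
    show "?S \<subseteq> {q}"
      using * by blast
    show "{q} \<subseteq> ?S"
      using *[OF b X(2)] X b by blast
  qed
  finally show ?thesis
    by simp
qed

text \<open>Elements over the terminal object live over \<open>Prod X\<close> times that object,
  whereas quantifiers and Henkin formulas live over \<open>Prod X\<close> itself. Reindexing along
  the isomorphism between the two mediates.\<close>

definition lift :: "('o \<times> 'l) list \<Rightarrow> 'p \<Rightarrow> 'p" where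
  "lift X = Rdx D (Prj1 (Base D) (Prod (Base D) X) (Trm (Base D)))"

lemma Prod_obj: "X \<in> J \<Longrightarrow> Prod (Base D) X \<in> Obj (Base D)"
  by (rule cat.Prod_obj[OF cat.ctxs_objD])

lemma ctx_proj_hom:
  "\<lbrakk>Z \<in> J; set X \<subseteq> set Z\<rbrakk> \<Longrightarrow> ctx_proj (Base D) Z X \<in> Hom (Base D) (Prod (Base D) Z) (Prod (Base D) X)"
  by (rule cat.ctx_proj_hom[OF cat.ctxs_objD])

lemma lift_closed:
  "\<lbrakk>X \<in> J; \<alpha> \<in> carrier (Fib D (Prod (Base D) X))\<rbrakk> \<Longrightarrow> lift X \<alpha> \<in> carrier (over X (Trm (Base D)))"
  unfolding lift_def by (rule rdx_mem[OF over_obj[OF _ cat.trm_obj] Prod_obj cat.prj1_hom[OF Prod_obj cat.trm_obj]])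

text \<open>Naturality of the first projection: the two sides reindex along the two paths of one
  commuting square.\<close>

lemma weaken_lift:
  assumes "X \<in> J" "Z \<in> J" "set X \<subseteq> set Z" "\<alpha> \<in> carrier (Fib D (Prod (Base D) X))"
  shows "weaken Z X (Trm (Base D)) (lift X \<alpha>) = lift Z (Rdx D (ctx_proj (Base D) Z X) \<alpha>)"
proof -
  note t = cat.trm_obj and X = Prod_obj[OF assms(1)] and Z = Prod_obj[OF assms(2)]
  note oX = over_obj[OF assms(1) t] and oZ = over_obj[OF assms(2) t]
  note p = ctx_proj_hom[OF assms(2,3)]
  show ?thesis
    unfolding lift_def
    using rdx_cmp[OF oZ oX X wk_hom[OF assms(2,3) t] cat.prj1_hom[OF X t] assms(4)]
      rdx_cmp[OF oZ Z X cat.prj1_hom[OF Z t] p assms(4)] cat.prj1_times_id[OF Z X t p]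
    by (simp add: wk_def)
qed

text \<open>The projection has the inverse \<open>s\<close>, the pairing of the identity with the
  terminal arrow. One composite with \<open>s\<close> yields reflection of the order, the other one
  surjectivity.\<close>

lemma
  assumes X: "X \<in> J"
  shows lift_reflects: "\<lbrakk>\<alpha> \<in> carrier (Fib D (Prod (Base D) X)); \<beta> \<in> carrier (Fib D (Prod (Base D) X));
      lift X \<alpha> \<sqsubseteq>\<^bsub>over X (Trm (Base D))\<^esub> lift X \<beta>\<rbrakk> \<Longrightarrow> \<alpha> \<sqsubseteq>\<^bsub>Fib D (Prod (Base D) X)\<^esub> \<beta>"
    and lift_surj: "\<gamma> \<in> carrier (over X (Trm (Base D)))
      \<Longrightarrow> \<exists>\<alpha> \<in> carrier (Fib D (Prod (Base D) X)). \<gamma> = lift X \<alpha>"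
proof -
  let ?C = "Base D"
  let ?X = "Prod ?C X" and ?t = "Trm ?C"
  note t = cat.trm_obj and o = Prod_obj[OF X] and ot = over_obj[OF X cat.trm_obj]
  define s where "s = pairing ?C ?X ?X ?t (Idn ?C ?X) (bang ?C ?X)"
  note c = o t o cat.idn_hom[OF o] cat.bang_hom[OF o]
  have s: "s \<in> Hom ?C ?X (?X \<Otimes>\<^bsub>?C\<^esub> ?t)" and ps: "Prj1 ?C ?X ?t \<cdot>\<^bsub>?C\<^esub> s = Idn ?C ?X"
    unfolding s_def by (fact cat.pairing_hom[OF c] cat.prj1_pairing[OF c])+
  note p = cat.prj1_hom[OF o t]
  have "Prj1 ?C ?X ?t \<cdot>\<^bsub>?C\<^esub> (s \<cdot>\<^bsub>?C\<^esub> Prj1 ?C ?X ?t) = Prj1 ?C ?X ?t \<cdot>\<^bsub>?C\<^esub> Idn ?C (?X \<Otimes>\<^bsub>?C\<^esub> ?t)"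
    using cat.cmp_assoc[OF ot o ot o p s p] cat.cmp_idn_left[OF ot o p] cat.cmp_idn_right[OF ot o p] ps
    by simp
  then have sp: "s \<cdot>\<^bsub>?C\<^esub> Prj1 ?C ?X ?t = Idn ?C (?X \<Otimes>\<^bsub>?C\<^esub> ?t)"
    by (rule cat.prod_trm_ext[OF ot o cat.cmp_hom[OF ot o ot p s] cat.idn_hom[OF ot]])
  have r: "Rdx D s (lift X \<alpha>) = \<alpha>" if "\<alpha> \<in> carrier (Fib D ?X)" for \<alpha>
    using rdx_cmp[OF o ot o s p that] rdx_idn[OF o that] ps by (simp add: lift_def)
  show "\<alpha> \<sqsubseteq>\<^bsub>Fib D ?X\<^esub> \<beta>"
    if "\<alpha> \<in> carrier (Fib D ?X)" "\<beta> \<in> carrier (Fib D ?X)" "lift X \<alpha> \<sqsubseteq>\<^bsub>over X ?t\<^esub> lift X \<beta>"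
    using rdx_le[OF o ot s lift_closed[OF X that(1)] lift_closed[OF X that(2)] that(3)] r that(1,2)
    by simp
  show "\<exists>\<alpha> \<in> carrier (Fib D ?X). \<gamma> = lift X \<alpha>" if "\<gamma> \<in> carrier (over X ?t)"
    using rdx_cmp[OF ot o ot p s that] rdx_idn[OF ot that] rdx_mem[OF o ot s that] sp
    by (intro bexI[of _ "Rdx D s \<gamma>"]) (simp_all add: lift_def)
qed

end

section \<open>Conservativity of a witnessing axiom\<close>

context implicational_doctrine
begin

text \<open>\<open>himp\<close> is a definite description, so uniqueness is required: two candidates
  bound the same elements, hence each other.\<close>

lemma is_himp_himp:
  assumes "A \<in> Obj (Base D)" "\<alpha> \<in> carrier (Fib D A)" "\<beta> \<in> carrier (Fib D A)"
  shows "is_himp (Fib D A) \<alpha> \<beta> (himp (Fib D A) \<alpha> \<beta>)"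
proof -
  interpret o: lower_semilattice "Fib D A"
    by (rule fib_meets[OF assms(1)])
  obtain \<gamma> where \<gamma>: "is_himp (Fib D A) \<alpha> \<beta> \<gamma>"
    using fib_himp[OF assms] by blast
  then show ?thesis
    unfolding himp_def
  proof (rule theI)
    show "\<delta> = \<gamma>" if "is_himp (Fib D A) \<alpha> \<beta> \<delta>" for \<delta>
      using that \<gamma> unfolding is_himp_def by (blast intro: o.le_antisym o.le_refl)
  qed
qed

lemma himp_closed:
  "\<lbrakk>A \<in> Obj (Base D); \<alpha> \<in> carrier (Fib D A); \<beta> \<in> carrier (Fib D A)\<rbrakk>
    \<Longrightarrow> himp (Fib D A) \<alpha> \<beta> \<in> carrier (Fib D A)"
  using is_himp_himp unfolding is_himp_def by blast

lemma le_himp_iff: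
  "\<lbrakk>A \<in> Obj (Base D); \<alpha> \<in> carrier (Fib D A); \<beta> \<in> carrier (Fib D A); \<xi> \<in> carrier (Fib D A)\<rbrakk>
    \<Longrightarrow> \<xi> \<sqsubseteq>\<^bsub>Fib D A\<^esub> himp (Fib D A) \<alpha> \<beta> \<longleftrightarrow> \<xi> \<sqinter>\<^bsub>Fib D A\<^esub> \<alpha> \<sqsubseteq>\<^bsub>Fib D A\<^esub> \<beta>"
  using is_himp_himp unfolding is_himp_def by blast

end

context existential_doctrine
begin

lemma Exq_galois:
  assumes "B \<in> Obj (Base D)" "E \<in> Obj (Base D)"
  shows "galois_connection \<lparr>orderA = Fib D (E \<Otimes>\<^bsub>Base D\<^esub> B), orderB = Fib D E,
    lower = Exq D B E, upper = Rdx D (Prj1 (Base D) E B)\<rparr>"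
  using someI_ex[OF exq_adjoint[OF assms]] unfolding Exq_def left_adjoint_def .

lemma Exq_closed:
  "\<lbrakk>B \<in> Obj (Base D); E \<in> Obj (Base D); \<alpha> \<in> carrier (Fib D (E \<Otimes>\<^bsub>Base D\<^esub> B))\<rbrakk>
    \<Longrightarrow> Exq D B E \<alpha> \<in> carrier (Fib D E)"
  using connection.lower_closed[OF galois_connection.axioms(1)[OF Exq_galois]] by simp

lemma Exq_le_iff:
  "\<lbrakk>B \<in> Obj (Base D); E \<in> Obj (Base D); \<alpha> \<in> carrier (Fib D (E \<Otimes>\<^bsub>Base D\<^esub> B)); \<beta> \<in> carrier (Fib D E)\<rbrakk>
    \<Longrightarrow> Exq D B E \<alpha> \<sqsubseteq>\<^bsub>Fib D E\<^esub> \<beta> \<longleftrightarrow> \<alpha> \<sqsubseteq>\<^bsub>Fib D (E \<Otimes>\<^bsub>Base D\<^esub> B)\<^esub> Rdx D (Prj1 (Base D) E B) \<beta>"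
  using galois_connection.galois_property[OF Exq_galois] by simp

end

context bounded_doctrine
begin

lemma bottom_least: "A \<in> Obj (Base D) \<Longrightarrow> least (Fib D A) \<bottom>\<^bsub>Fib D A\<^esub> (carrier (Fib D A))"
  unfolding bottom_def by (rule someI_ex[OF bounded_bottom])

lemma top_greatest: "A \<in> Obj (Base D) \<Longrightarrow> greatest (Fib D A) \<top>\<^bsub>Fib D A\<^esub> (carrier (Fib D A))"
  unfolding top_def by (rule someI_ex[OF bounded_top])

lemma bottom_mem: "A \<in> Obj (Base D) \<Longrightarrow> \<bottom>\<^bsub>Fib D A\<^esub> \<in> carrier (Fib D A)"
  using bottom_least by (rule least_closed)

lemma top_mem: "A \<in> Obj (Base D) \<Longrightarrow> \<top>\<^bsub>Fib D A\<^esub> \<in> carrier (Fib D A)"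
  using top_greatest by (rule greatest_closed)

lemma bottom_le: "\<lbrakk>A \<in> Obj (Base D); \<alpha> \<in> carrier (Fib D A)\<rbrakk> \<Longrightarrow> \<bottom>\<^bsub>Fib D A\<^esub> \<sqsubseteq>\<^bsub>Fib D A\<^esub> \<alpha>"
  using bottom_least by (rule least_le)

lemma le_top: "\<lbrakk>A \<in> Obj (Base D); \<alpha> \<in> carrier (Fib D A)\<rbrakk> \<Longrightarrow> \<alpha> \<sqsubseteq>\<^bsub>Fib D A\<^esub> \<top>\<^bsub>Fib D A\<^esub>"
  using top_greatest by (rule greatest_le)

text \<open>If top were below bottom, every element would be squeezed onto bottom and the fiber
  would be a singleton.\<close>

lemma not_top_le_bottom:
  assumes A: "A \<in> Obj (Base D)" and "\<not> is_singleton (carrier (Fib D A))"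
  shows "\<not> \<top>\<^bsub>Fib D A\<^esub> \<sqsubseteq>\<^bsub>Fib D A\<^esub> \<bottom>\<^bsub>Fib D A\<^esub>"
proof
  assume le: "\<top>\<^bsub>Fib D A\<^esub> \<sqsubseteq>\<^bsub>Fib D A\<^esub> \<bottom>\<^bsub>Fib D A\<^esub>"
  interpret o: partial_order "Fib D A"
    by (rule fib_order[OF A])
  note m = top_mem[OF A] bottom_mem[OF A]
  have "\<alpha> = \<bottom>\<^bsub>Fib D A\<^esub>" if "\<alpha> \<in> carrier (Fib D A)" for \<alpha>
    using o.le_trans[OF le_top[OF A that] le that m] bottom_le[OF A that] that m(2)
    by (rule o.le_antisym)
  then have "carrier (Fib D A) = {\<bottom>\<^bsub>Fib D A\<^esub>}"
    using m(2) by blast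
  then show False
    using assms(2) by simp
qed

end

locale bounded_existential_implicational_doctrine =
  bounded_doctrine D + existential_doctrine D + implicational_doctrine D
  for D :: "('o, 'a, 'p) doctrine_data"
begin

text \<open>The witnessing constant is here the variable of sort \<open>B\<close>. The conclusion
  stays over the product with \<open>B\<close>: it need not descend to \<open>E\<close>, as
  \<open>p\<close> may identify a consistent \<open>\<chi>\<close> with bottom. In the colimit this
  makes no difference, since a larger list may be used.\<close>

lemma witness_axiom_conservative:
  assumes B: "B \<in> Obj (Base D)" and E: "E \<in> Obj (Base D)"
    and \<phi>: "\<phi> \<in> carrier (Fib D (E \<Otimes>\<^bsub>Base D\<^esub> B))" and \<chi>: "\<chi> \<in> carrier (Fib D E)"
  defines "F \<equiv> Fib D (E \<Otimes>\<^bsub>Base D\<^esub> B)" and "p \<equiv> Rdx D (Prj1 (Base D) E B)"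
  assumes le: "p \<chi> \<sqinter>\<^bsub>F\<^esub> himp F (p (Exq D B E \<phi>)) \<phi> \<sqsubseteq>\<^bsub>F\<^esub> \<bottom>\<^bsub>F\<^esub>"
  shows "p \<chi> \<sqsubseteq>\<^bsub>F\<^esub> \<bottom>\<^bsub>F\<^esub>"
proof -
  note EB = cat.prd_obj[OF E B] and pr = cat.prj1_hom[OF E B]
  interpret F: lower_semilattice F
    unfolding F_def by (rule fib_meets[OF EB])
  interpret G: lower_semilattice "Fib D E"
    by (rule fib_meets[OF E])
  note ex = Exq_closed[OF B E \<phi>]
  have c: "\<phi> \<in> carrier F" "p \<chi> \<in> carrier F" "p (Exq D B E \<phi>) \<in> carrier F" "\<bottom>\<^bsub>F\<^esub> \<in> carrier F"
    unfolding F_def p_def using \<phi> rdx_mem[OF EB E pr] \<chi> ex bottom_mem[OF EB] by simp_all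
  let ?h = "himp F (p (Exq D B E \<phi>)) \<phi>"
  have h: "?h \<in> carrier F" "\<And>\<xi>. \<xi> \<in> carrier F \<Longrightarrow> \<xi> \<sqsubseteq>\<^bsub>F\<^esub> ?h \<longleftrightarrow> \<xi> \<sqinter>\<^bsub>F\<^esub> p (Exq D B E \<phi>) \<sqsubseteq>\<^bsub>F\<^esub> \<phi>"
    using himp_closed[OF EB] le_himp_iff[OF EB] c unfolding F_def by simp_all
  have bot: "p \<bottom>\<^bsub>Fib D E\<^esub> = \<bottom>\<^bsub>F\<^esub>"
    unfolding p_def F_def by (rule bounded_rdx_bottom[OF EB E pr])
  have "\<phi> \<sqsubseteq>\<^bsub>F\<^esub> ?h"
    using h(2)[OF c(1)] F.meet_left[OF c(1,3)] by simp
  then have "\<phi> \<sqinter>\<^bsub>F\<^esub> p \<chi> \<sqsubseteq>\<^bsub>F\<^esub> p \<chi> \<sqinter>\<^bsub>F\<^esub> ?h"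
    using F.le_trans[OF F.meet_left[OF c(1,2)] _ _ c(1) h(1)] F.meet_right[OF c(1,2)] c h(1)
    by (simp add: F.le_meet_iff)
  \<comment> \<open>Writing bottom as a reindexed bottom gives the form that the adjunction between
    \<open>Exq\<close> and \<open>p\<close> accepts.\<close>
  then have "\<phi> \<sqinter>\<^bsub>F\<^esub> p \<chi> \<sqsubseteq>\<^bsub>F\<^esub> p \<bottom>\<^bsub>Fib D E\<^esub>"
    unfolding bot
    using le F.meet_closed[OF c(1,2)] F.meet_closed[OF c(2) h(1)] c(4) by (rule F.le_trans)
  then have "Exq D B E (\<phi> \<sqinter>\<^bsub>F\<^esub> p \<chi>) \<sqsubseteq>\<^bsub>Fib D E\<^esub> \<bottom>\<^bsub>Fib D E\<^esub>"
    using Exq_le_iff[OF B E _ bottom_mem[OF E]] F.meet_closed[OF c(1,2)] unfolding F_def p_def by simp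
  then have "Exq D B E \<phi> \<sqinter>\<^bsub>Fib D E\<^esub> \<chi> \<sqsubseteq>\<^bsub>Fib D E\<^esub> \<bottom>\<^bsub>Fib D E\<^esub>"
    using frobenius[OF B E \<phi> \<chi>] unfolding F_def p_def by simp
  then have "p (\<chi> \<sqinter>\<^bsub>Fib D E\<^esub> Exq D B E \<phi>) \<sqsubseteq>\<^bsub>F\<^esub> \<bottom>\<^bsub>F\<^esub>"
    using rdx_le[OF EB E pr _ bottom_mem[OF E]] G.meet_closed[OF \<chi> ex] bot
    unfolding F_def p_def by (simp add: meet_comm[of "Fib D E" \<chi>])
  then have "p \<chi> \<sqinter>\<^bsub>F\<^esub> p (Exq D B E \<phi>) \<sqsubseteq>\<^bsub>F\<^esub> \<bottom>\<^bsub>F\<^esub>"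
    using rdx_meet[OF EB E pr \<chi> ex] unfolding F_def p_def by simp
  \<comment> \<open>Ex falso turns the inconsistency with Ex phi into the entailment of phi that
    defines the implication.\<close>
  moreover have "\<bottom>\<^bsub>F\<^esub> \<sqsubseteq>\<^bsub>F\<^esub> \<phi>"
    unfolding F_def by (rule bottom_le[OF EB \<phi>])
  ultimately have "p \<chi> \<sqinter>\<^bsub>F\<^esub> p (Exq D B E \<phi>) \<sqsubseteq>\<^bsub>F\<^esub> \<phi>"
    using F.le_trans F.meet_closed[OF c(2,3)] c by blast
  then have "p \<chi> \<sqsubseteq>\<^bsub>F\<^esub> p \<chi> \<sqinter>\<^bsub>F\<^esub> ?h"
    using h(2)[OF c(2)] c(2) h(1) by (simp add: F.le_meet_iff)
  then show ?thesis
    using le F.le_trans[OF _ _ c(2) F.meet_closed[OF c(2) h(1)] c(4)] by blast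
qed

end

section \<open>Consistency of finitely many witnessing axioms\<close>

text \<open>The maximum is taken among the elements of \<open>S\<close>, not among the values of
  \<open>f\<close>, because it has to name an axiom; distinct elements may share a value.\<close>

lemma (in wo_rel) finite_has_max:
  assumes "finite S" "S \<noteq> {}" "f ` S \<subseteq> Field r"
  shows "\<exists>v \<in> S. \<forall>w \<in> S. (f w, f v) \<in> r"
  using assms
proof (induction S rule: finite_ne_induct)
  case (singleton x)
  then show ?case
    using REFL by (auto simp: refl_on_def)
next
  case (insert x S)
  then obtain v where v: "v \<in> S" "\<forall>w \<in> S. (f w, f v) \<in> r"
    by auto
  have "(f x, f x) \<in> r"
    using insert.prems REFL by (auto simp: refl_on_def)
  moreover have "(f x, f v) \<in> r \<or> (f v, f x) \<in> r"
    using insert.prems v(1) TOTALS by auto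
  ultimately show ?case
    using v TRANS unfolding trans_def by blast
qed

locale henkin_construction =
  bounded_existential_implicational_doctrine D + doctrine_with_constants D r
  for D :: "('o, 'a, 'p) doctrine_data" and r :: "'l rel" +
  fixes L :: "('o, 'p, 'l) listing"
  assumes nontrivial: "A \<in> Obj (Base D) \<Longrightarrow> \<not> is_singleton (carrier (Fib D A))"
    and well_order: "Well_order r"
    and listing: "is_listing D r L"
begin

section \<open>Ordinals of the witnessing constants\<close>

sublocale wo: wo_rel r
  by (simp add: wo_rel_def well_order)

lemma
  assumes "B \<in> Obj (Base D)" "j \<in> Field r"
  shows listing_ctx: "snd (L B j) \<in> J"
    and listing_formula: "fst (L B j) \<in> carrier (Fib D (Prod (Base D) (snd (L B j)) \<Otimes>\<^bsub>Base D\<^esub> B))"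
    and listing_AboveS: "AboveS r (witness r L B ` underS r j \<union> const_indices r L B j) \<noteq> {}"
  using listing assms unfolding is_listing_def by blast+

lemma const_indices_Field:
  assumes "B \<in> Obj (Base D)"
  shows "const_indices r L B j \<subseteq> Field r"
proof -
  have "k \<in> Field r" if "k \<in> under r j" for k
    using that by (auto simp: under_def Field_def)
  then show ?thesis
    using listing_ctx[OF assms] unfolding const_indices_def ctxs_def by fastforce
qed

text \<open>\<open>wo_rel.suc\<close> behaves as a successor only for subsets of the field with a
  strict upper bound. The bound comes from the listing; the inclusion concerns the witnesses at
  smaller indices, whence the induction.\<close>

lemma witness_Field:
  assumes B: "B \<in> Obj (Base D)"
  shows "j \<in> Field r \<Longrightarrow> witness r L B j \<in> Field r"
proof (induction j rule: wo.well_order_induct)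
  case (1 j)
  have "witness r L B k \<in> Field r" if "k \<in> underS r j" for k
    using 1 that by (auto simp: underS_def Field_def)
  then have "witness r L B ` underS r j \<union> const_indices r L B j \<subseteq> Field r"
    using const_indices_Field[OF B] by auto
  from wo.suc_inField[OF this listing_AboveS[OF B 1(2)]] show ?case
    by (subst witness_rec[OF well_order])
qed

lemma witness_greater:
  assumes B: "B \<in> Obj (Base D)" and j: "j \<in> Field r"
    and x: "x \<in> witness r L B ` underS r j \<union> const_indices r L B j"
  shows "(x, witness r L B j) \<in> r" "x \<noteq> witness r L B j"
proof -
  have "underS r j \<subseteq> Field r"
    by (auto simp: underS_def Field_def)
  then have "witness r L B k \<in> Field r" if "k \<in> underS r j" for k
    using that witness_Field[OF B] by blast
  then have "witness r L B ` underS r j \<union> const_indices r L B j \<subseteq> Field r"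
    using const_indices_Field[OF B] by auto
  from wo.suc_greater[OF this listing_AboveS[OF B j] x]
  show "(x, witness r L B j) \<in> r" "x \<noteq> witness r L B j"
    by (metis witness_rec[OF well_order])+
qed

text \<open>Within one sort the witnesses increase strictly, since earlier ones are among the
  ordinals a later one must exceed. Across sorts they may coincide, but there the sort itself
  separates the constants.\<close>

lemma witness_inj:
  assumes B: "B \<in> Obj (Base D)" and "j \<in> Field r" "k \<in> Field r" "witness r L B j = witness r L B k"
  shows "j = k"
proof (rule ccontr)
  assume "j \<noteq> k"
  moreover have "(j, k) \<in> r \<or> (k, j) \<in> r"
    using wo.TOTALS assms(2,3) by blast
  ultimately have "j \<in> underS r k \<or> k \<in> underS r j"
    by (auto simp: underS_def)
  then show False
    using witness_greater(2)[OF B assms(2)] witness_greater(2)[OF B assms(3)] assms(4) by fastforce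
qed

text \<open>It matters that \<open>const_indices\<close> includes the index \<open>j\<close> itself:
  the constants of the formula, of whatever sort, then lie below its own witness.\<close>

lemma listing_index_less:
  assumes "B \<in> Obj (Base D)" "j \<in> Field r" "(A, x) \<in> set (snd (L B j))"
  shows "(x, witness r L B j) \<in> r" "x \<noteq> witness r L B j"
proof -
  have "x \<in> const_indices r L B j"
    using assms wo.REFL unfolding const_indices_def under_def refl_on_def by force
  then show "(x, witness r L B j) \<in> r" "x \<noteq> witness r L B j"
    using witness_greater[OF assms(1,2)] by auto
qed

lemma star_ctx:
  assumes "B \<in> Obj (Base D)" "j \<in> Field r"
  shows "star r L B j \<in> J"
  using listing_ctx[OF assms] listing_index_less(2)[OF assms] witness_Field[OF assms] assms(1)
  unfolding star_def ctxs_def by auto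

text \<open>The constant of \<open>(B, j)\<close> may occur in the formula of some \<open>(A, k)\<close> in \<open>U\<close>, even with
  \<open>A \<noteq> B\<close>; comparing the ordinals of the constants across all sorts excludes cycles.\<close>

lemma maximal_witness_fresh:
  assumes U: "U \<subseteq> Obj (Base D) \<times> Field r" and "(B, j) \<in> U"
    and max: "\<And>A k. (A, k) \<in> U \<Longrightarrow> (witness r L A k, witness r L B j) \<in> r"
    and "(A, k) \<in> U" "(A, k) \<noteq> (B, j)"
  shows "(B, witness r L B j) \<notin> set (star r L A k)"
proof
  assume "(B, witness r L B j) \<in> set (star r L A k)"
  then consider "A = B" "witness r L B j = witness r L A k" | "(B, witness r L B j) \<in> set (snd (L A k))"
    unfolding star_def by auto
  then show False
  proof cases
    \<comment> \<open>Both axioms have the same sort and the same new constant, so their indices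
      agree.\<close>
    case 1
    then show False
      using witness_inj[of B j k] assms by auto
  next
    \<comment> \<open>The witness of \<open>(B, j)\<close> would lie strictly below that of
      \<open>(A, k)\<close>, against its maximality.\<close>
    case 2
    then show False
      using listing_index_less[of A k B "witness r L B j"] max[OF assms(4)] U assms(4) wo.ANTISYM
      unfolding antisym_def by blast
  qed
qed

section \<open>Henkin formulas over larger lists\<close>

lemma henkin_closed:
  assumes "B \<in> Obj (Base D)" "j \<in> Field r"
  shows "henkin D L B j \<in> carrier (Fib D (Prod (Base D) (star r L B j)))"
proof -
  note X = Prod_obj[OF listing_ctx[OF assms]]
  note XB = cat.prd_obj[OF X assms(1)] and f = listing_formula[OF assms]
  note e = Exq_closed[OF assms(1) X f]
  from himp_closed[OF XB rdx_mem[OF XB X cat.prj1_hom[OF X assms(1)] e] f]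
  show ?thesis
    by (simp add: henkin_def star_def case_prod_unfold Let_def)
qed

lemma henkin_elt_pres:
  "\<lbrakk>B \<in> Obj (Base D); j \<in> Field r\<rbrakk>
    \<Longrightarrow> (lift (star r L B j) (henkin D L B j), star r L B j) \<in> pres (Trm (Base D))"
  using lift_closed[OF star_ctx henkin_closed] star_ctx by simp

lemma henkin_elt_eq:
  "henkin_elt D r L (B, j) = uelt D r (Trm (Base D)) (lift (star r L B j) (henkin D L B j)) (star r L B j)"
  by (simp add: henkin_elt_def lift_def)

text \<open>Enlarging the list behind the witnessing constant keeps the form of the axiom:
  reindexing passes through the implication, and through the quantifier by Beck-Chevalley. The
  formula obtained is the listed one, weakened to \<open>Z\<close>.\<close>

lemma rdx_henkin:
  assumes B: "B \<in> Obj (Base D)" and j: "j \<in> Field r"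
    and Z: "Z \<in> J" "set (snd (L B j)) \<subseteq> set Z"
  obtains \<phi> where "\<phi> \<in> carrier (Fib D (Prod (Base D) Z \<Otimes>\<^bsub>Base D\<^esub> B))"
    "Rdx D (ctx_proj (Base D) (Z @ [(B, witness r L B j)]) (star r L B j)) (henkin D L B j)
      = himp (Fib D (Prod (Base D) Z \<Otimes>\<^bsub>Base D\<^esub> B))
          (Rdx D (Prj1 (Base D) (Prod (Base D) Z) B) (Exq D B (Prod (Base D) Z) \<phi>)) \<phi>"
proof -
  let ?C = "Base D"
  let ?X = "Prod ?C (snd (L B j))" and ?Z = "Prod ?C Z" and ?f = "fst (L B j)"
  let ?g = "ctx_proj ?C Z (snd (L B j))"
  let ?k = "times_id ?C ?Z ?X B ?g"
  note X = Prod_obj[OF listing_ctx[OF B j]] and oZ = Prod_obj[OF Z(1)] and f = listing_formula[OF B j]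
  note XB = cat.prd_obj[OF X B] and ZB = cat.prd_obj[OF oZ B]
  note p = cat.prj1_hom[OF X B] and q = cat.prj1_hom[OF oZ B] and g = ctx_proj_hom[OF Z]
  note k = cat.times_id_hom[OF oZ X B g] and e = Exq_closed[OF B X f]
  \<comment> \<open>Without this the projection would not be \<open>?g\<close> times the identity,
    as a component of \<open>?g\<close> would have to read the last factor.\<close>
  have fresh: "(B, witness r L B j) \<notin> set (snd (L B j))"
    using listing_index_less(2)[OF B j] by blast
  have "Rdx D ?k (Rdx D (Prj1 ?C ?X B) (Exq D B ?X ?f)) = Rdx D (Prj1 ?C ?Z B) (Rdx D ?g (Exq D B ?X ?f))"
    using rdx_cmp[OF ZB XB X k p e] rdx_cmp[OF ZB oZ X q g e] cat.prj1_times_id[OF oZ X B g] by simp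
  also have "Rdx D ?g (Exq D B ?X ?f) = Exq D B ?Z (Rdx D ?k ?f)"
    using beck_chevalley[OF B oZ X g f] by simp
  finally have "Rdx D ?k (henkin D L B j) = himp (Fib D (?Z \<Otimes>\<^bsub>?C\<^esub> B))
      (Rdx D (Prj1 ?C ?Z B) (Exq D B ?Z (Rdx D ?k ?f))) (Rdx D ?k ?f)"
    using rdx_himp[OF ZB XB k rdx_mem[OF XB X p e] f]
    by (simp add: henkin_def case_prod_unfold Let_def)
  then show thesis
    using rdx_mem[OF ZB XB k f] that
      cat.ctx_proj_snoc_snoc[OF cat.ctxs_objD[OF Z(1)] B Z(2) fresh]
    by (simp add: star_def)
qed

text \<open>Falsum, presented over the empty list so that it can be weakened to every list, where it
  becomes the bottom of the fiber.\<close>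

definition ubot :: "('o, 'p, 'l) uelt" where
  "ubot = uelt D r (Trm (Base D)) \<bottom>\<^bsub>over [] (Trm (Base D))\<^esub> []"

lemma nil_ctx: "[] \<in> J"
  by (simp add: ctxs_def)

lemma bottom_pres: "(\<bottom>\<^bsub>over [] (Trm (Base D))\<^esub>, []) \<in> pres (Trm (Base D))"
  using nil_ctx bottom_mem[OF over_obj[OF nil_ctx cat.trm_obj]] by simp

lemma ubot_closed: "ubot \<in> carrier (ufib D r (Trm (Base D)))"
  unfolding ubot_def by (rule uelt_closed[OF bottom_pres])

lemma weaken_bottom:
  "\<lbrakk>Z \<in> J; set X \<subseteq> set Z; X \<in> J\<rbrakk>
    \<Longrightarrow> weaken Z X (Trm (Base D)) \<bottom>\<^bsub>over X (Trm (Base D))\<^esub> = \<bottom>\<^bsub>over Z (Trm (Base D))\<^esub>"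
  by (rule bounded_rdx_bottom[OF over_obj over_obj wk_hom]) (auto intro: cat.trm_obj)

lemma weaken_top:
  "\<lbrakk>Z \<in> J; set X \<subseteq> set Z; X \<in> J\<rbrakk>
    \<Longrightarrow> weaken Z X (Trm (Base D)) \<top>\<^bsub>over X (Trm (Base D))\<^esub> = \<top>\<^bsub>over Z (Trm (Base D))\<^esub>"
  by (rule bounded_rdx_top[OF over_obj over_obj wk_hom]) (auto intro: cat.trm_obj)

text \<open>Inconsistency in the colimit is inconsistency at one list, which is what brings the
  question back to a fiber of the original doctrine.\<close>

lemma le_ubot_iff:
  assumes "(\<alpha>, X) \<in> pres (Trm (Base D))"
  shows "uelt D r (Trm (Base D)) \<alpha> X \<sqsubseteq>\<^bsub>ufib D r (Trm (Base D))\<^esub> ubot \<longleftrightarrow>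
    (\<exists>Z \<in> J. set X \<subseteq> set Z \<and> weaken Z X (Trm (Base D)) \<alpha> \<sqsubseteq>\<^bsub>over Z (Trm (Base D))\<^esub> \<bottom>\<^bsub>over Z (Trm (Base D))\<^esub>)"
  unfolding ubot_def uelt_le_iff[OF cat.trm_obj assms bottom_pres]
  using weaken_bottom[OF _ _ nil_ctx] by auto

lemma weaken_le_bottom:
  assumes p: "(\<alpha>, X) \<in> pres (Trm (Base D))" and Z: "Z \<in> J" "Z' \<in> J" "set X \<subseteq> set Z" "set Z \<subseteq> set Z'"
    and "weaken Z X (Trm (Base D)) \<alpha> \<sqsubseteq>\<^bsub>over Z (Trm (Base D))\<^esub> \<bottom>\<^bsub>over Z (Trm (Base D))\<^esub>"
  shows "weaken Z' X (Trm (Base D)) \<alpha> \<sqsubseteq>\<^bsub>over Z' (Trm (Base D))\<^esub> \<bottom>\<^bsub>over Z' (Trm (Base D))\<^esub>"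
  using weaken_le[OF cat.trm_obj p bottom_pres Z(1,2,3) _ Z(4)] assms(6)
    weaken_bottom[OF Z(1) _ nil_ctx] weaken_bottom[OF Z(2) _ nil_ctx]
  by simp

text \<open>At a suitable list the fiber is that of a product \<open>Prod Z\<close> times
  \<open>B\<close>, with the fresh constant as last factor. There \<open>\<gamma>\<close> is a
  weakening from \<open>Prod Z\<close> and the axiom is again of Henkin form, so that
  \<open>witness_axiom_conservative\<close> applies with \<open>Prod Z\<close> in the role of
  \<open>E\<close>.\<close>

lemma henkin_axiom_conservative:
  assumes B: "B \<in> Obj (Base D)" and j: "j \<in> Field r"
    and p: "(\<gamma>, X) \<in> pres (Trm (Base D))" and fresh: "(B, witness r L B j) \<notin> set X"
    and le: "uelt D r (Trm (Base D)) \<gamma> X \<sqinter>\<^bsub>ufib D r (Trm (Base D))\<^esub> henkin_elt D r L (B, j)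
      \<sqsubseteq>\<^bsub>ufib D r (Trm (Base D))\<^esub> ubot"
  shows "uelt D r (Trm (Base D)) \<gamma> X \<sqsubseteq>\<^bsub>ufib D r (Trm (Base D))\<^esub> ubot"
proof -
  let ?C = "Base D"
  let ?t = "Trm ?C" and ?d = "witness r L B j"
  let ?s = "star r L B j" and ?h = "henkin D L B j"
  note t = cat.trm_obj and s = star_ctx[OF B j] and hc = henkin_closed[OF B j]
    and hp = henkin_elt_pres[OF B j]
  have X: "X \<in> J"
    using p by simp
  \<comment> \<open>The formula is stripped of its terminal factor, so that the quantifier along
    \<open>B\<close> can act.\<close>
  obtain \<chi> where \<chi>: "\<chi> \<in> carrier (Fib D (Prod ?C X))" and [simp]: "\<gamma> = lift X \<chi>"
    using lift_surj[OF X] p by auto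
  obtain Y where Y: "Y \<in> J" "set Y = set X \<union> set ?s"
    using X s by (rule ctxs_join)
  then have sY: "set X \<subseteq> set Y" "set ?s \<subseteq> set Y"
    by auto
  let ?m = "weaken Y X ?t \<gamma> \<sqinter>\<^bsub>over Y ?t\<^esub> weaken Y ?s ?t (lift ?s ?h)"
  interpret Y: lower_semilattice "over Y ?t"
    by (rule fib_meets[OF over_obj[OF Y(1) t]])
  note w = weaken_closed[OF t p Y(1) sY(1)] weaken_closed[OF t hp Y(1) sY(2)]
  have wp: "(weaken Y X ?t \<gamma>, Y) \<in> pres ?t" "(weaken Y ?s ?t (lift ?s ?h), Y) \<in> pres ?t"
    using w Y(1) by simp_all
  have mp: "(?m, Y) \<in> pres ?t"
    using Y.meet_closed[OF w] Y(1) by simp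
  have "uelt D r ?t ?m Y \<sqsubseteq>\<^bsub>ufib D r ?t\<^esub> ubot"
    using le uelt_meet[OF t wp] uelt_weaken[OF t p Y(1) sY(1)] uelt_weaken[OF t hp Y(1) sY(2)]
    by (simp add: henkin_elt_eq)
  then obtain V where V: "V \<in> J" "set Y \<subseteq> set V" "weaken V Y ?t ?m \<sqsubseteq>\<^bsub>over V ?t\<^esub> \<bottom>\<^bsub>over V ?t\<^esub>"
    unfolding le_ubot_iff[OF mp] by blast
  have dV: "(B, ?d) \<in> set V"
    using V(2) sY(2) by (auto simp: star_def)
  \<comment> \<open>In \<open>V\<close> the new constant may stand anywhere. Removing it and
    appending it again only permutes the list, and makes the product end in the factor
    \<open>B\<close>.\<close>
  define Z where "Z = removeAll (B, ?d) V"
  define Z' where "Z' = Z @ [(B, ?d)]"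
  have ZJ: "Z \<in> J" and Z'J: "Z' \<in> J" and VZ': "set V = set Z'"
    using V(1) dV by (auto simp: Z_def Z'_def ctxs_def distinct_removeAll)
  have sZ: "set X \<subseteq> set Z" "set (snd (L B j)) \<subseteq> set Z"
    using V(2) sY fresh listing_index_less(2)[OF B j] by (auto simp: Z_def star_def)
  have sZ': "set Y \<subseteq> set Z'" "set X \<subseteq> set Z'" "set ?s \<subseteq> set Z'"
    using V(2) VZ' sY by auto
  let ?Z = "Prod ?C Z"
  let ?F = "Fib D (?Z \<Otimes>\<^bsub>?C\<^esub> B)" and ?p = "Rdx D (Prj1 ?C ?Z B)"
  have PZ': "Prod ?C Z' = ?Z \<Otimes>\<^bsub>?C\<^esub> B"
    by (simp add: Z'_def)
  note oZ = Prod_obj[OF ZJ] and oZ' = Prod_obj[OF Z'J]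
  define \<chi>' where "\<chi>' = Rdx D (ctx_proj ?C Z X) \<chi>"
  have \<chi>': "\<chi>' \<in> carrier (Fib D ?Z)"
    unfolding \<chi>'_def by (rule rdx_mem[OF oZ Prod_obj[OF X] ctx_proj_hom[OF ZJ sZ(1)] \<chi>])
  obtain \<phi> where \<phi>: "\<phi> \<in> carrier ?F"
    and h: "Rdx D (ctx_proj ?C Z' ?s) ?h = himp ?F (?p (Exq D B ?Z \<phi>)) \<phi>"
    unfolding Z'_def by (rule rdx_henkin[OF B j ZJ sZ(2)])
  \<comment> \<open>Freshness enters here: the projection to \<open>X\<close> ignores the last
    factor, so \<open>\<chi>\<close> becomes a weakening of \<open>\<chi>'\<close>.\<close>
  have "Rdx D (ctx_proj ?C Z' X) \<chi> = ?p \<chi>'"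
    unfolding \<chi>'_def Z'_def cat.ctx_proj_snoc_fresh[OF cat.ctxs_objD[OF ZJ] B sZ(1) fresh]
    by (rule rdx_cmp[OF cat.prd_obj[OF oZ B] oZ Prod_obj[OF X] cat.prj1_hom[OF oZ B] ctx_proj_hom[OF ZJ sZ(1)] \<chi>])
  then have wX: "weaken Z' X ?t \<gamma> = lift Z' (?p \<chi>')"
    using weaken_lift[OF X Z'J sZ'(2) \<chi>] by simp
  have wS: "weaken Z' ?s ?t (lift ?s ?h) = lift Z' (himp ?F (?p (Exq D B ?Z \<phi>)) \<phi>)"
    using weaken_lift[OF s Z'J sZ'(3) hc] h by simp
  note oF = cat.prd_obj[OF oZ B]
  interpret F: lower_semilattice ?F
    by (rule fib_meets[OF oF])
  have c: "?p \<chi>' \<in> carrier ?F" "himp ?F (?p (Exq D B ?Z \<phi>)) \<phi> \<in> carrier ?F"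
    using rdx_mem[OF oF oZ cat.prj1_hom[OF oZ B]] \<chi>' Exq_closed[OF B oZ \<phi>] himp_closed[OF oF _ \<phi>] by blast+
  note l = over_obj[OF Z'J t] oZ' cat.prj1_hom[OF oZ' t]
  have lbot: "lift Z' \<bottom>\<^bsub>?F\<^esub> = \<bottom>\<^bsub>over Z' ?t\<^esub>"
    using bounded_rdx_bottom[OF l] unfolding lift_def PZ' by simp
  have "weaken Z' Y ?t ?m = weaken Z' X ?t \<gamma> \<sqinter>\<^bsub>over Z' ?t\<^esub> weaken Z' ?s ?t (lift ?s ?h)"
    using rdx_meet[OF over_obj[OF Z'J t] over_obj[OF Y(1) t] wk_hom[OF Z'J sZ'(1) t] w]
      weaken_weaken[OF t p Y(1) Z'J sY(1) sZ'(1)] weaken_weaken[OF t hp Y(1) Z'J sY(2) sZ'(1)]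
    by simp
  also have "\<dots> = lift Z' (?p \<chi>' \<sqinter>\<^bsub>?F\<^esub> himp ?F (?p (Exq D B ?Z \<phi>)) \<phi>)"
    using rdx_meet[OF l] c unfolding wX wS unfolding lift_def PZ' by simp
  \<comment> \<open>The inequality at \<open>V\<close> passes to \<open>Z'\<close> because the two
    lists have the same entries.\<close>
  finally have "lift Z' (?p \<chi>' \<sqinter>\<^bsub>?F\<^esub> himp ?F (?p (Exq D B ?Z \<phi>)) \<phi>) \<sqsubseteq>\<^bsub>over Z' ?t\<^esub> lift Z' \<bottom>\<^bsub>?F\<^esub>"
    using weaken_le_bottom[OF mp V(1) Z'J V(2) _ V(3)] VZ' lbot by simp
  then have "?p \<chi>' \<sqinter>\<^bsub>?F\<^esub> himp ?F (?p (Exq D B ?Z \<phi>)) \<phi> \<sqsubseteq>\<^bsub>?F\<^esub> \<bottom>\<^bsub>?F\<^esub>"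
    using lift_reflects[OF Z'J] F.meet_closed[OF c] bottom_mem[OF oF] unfolding PZ' by blast
  then have "?p \<chi>' \<sqsubseteq>\<^bsub>?F\<^esub> \<bottom>\<^bsub>?F\<^esub>"
    by (rule witness_axiom_conservative[OF B oZ \<phi> \<chi>'])
  then have "weaken Z' X ?t \<gamma> \<sqsubseteq>\<^bsub>over Z' ?t\<^esub> \<bottom>\<^bsub>over Z' ?t\<^esub>"
    using rdx_le[OF l] c(1) bottom_mem[OF oF] unfolding wX lbot[symmetric] unfolding lift_def PZ' by blast
  then show ?thesis
    unfolding le_ubot_iff[OF p] using Z'J sZ'(2) by blast
qed

end

section \<open>Finite meets of witnessing axioms\<close>

context henkin_construction
begin

abbreviation u :: "('o, 'p, 'l) uelt gorder" where
  "u \<equiv> ufib D r (Trm (Base D))"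

sublocale u: lower_semilattice u
  by (rule lower_semilattice_ufib[OF cat.trm_obj])

text \<open>Besides the universal property, the presentation is recorded: its list contains exactly
  the constants of the axioms in \<open>U\<close>. Freshness of another constant can then be tested
  on these axioms one by one.\<close>

lemma henkin_meet_glb:
  assumes "finite U" "U \<subseteq> Obj (Base D) \<times> Field r"
  obtains \<gamma> X where "(\<gamma>, X) \<in> pres (Trm (Base D))"
    "set X = (\<Union>(B, j) \<in> U. set (star r L B j))"
    "henkin_meet D r L U = uelt D r (Trm (Base D)) \<gamma> X"
    "greatest u (henkin_meet D r L U) (Lower u (henkin_elt D r L ` U))"
proof -
  let ?t = "Trm (Base D)"
  note t = cat.trm_obj
  have "\<exists>\<gamma> X. (\<gamma>, X) \<in> pres ?t \<and> set X = (\<Union>(B, j) \<in> U. set (star r L B j)) \<and>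
      greatest u (uelt D r ?t \<gamma> X) (Lower u (henkin_elt D r L ` U))"
    using assms
  proof (induction U rule: finite_induct)
    case empty
    have p: "(\<top>\<^bsub>over [] ?t\<^esub>, []) \<in> pres ?t"
      using nil_ctx top_mem[OF over_obj[OF nil_ctx t]] by simp
    \<comment> \<open>Any element can be compared with the empty conjunction over its own list,
      where top weakens to top.\<close>
    have "x \<sqsubseteq>\<^bsub>u\<^esub> uelt D r ?t \<top>\<^bsub>over [] ?t\<^esub> []" if x: "x \<in> carrier u" for x
    proof -
      obtain \<alpha> X where x: "(\<alpha>, X) \<in> pres ?t" "x = uelt D r ?t \<alpha> X"
        using x unfolding ufib_carrier by blast
      then have X: "X \<in> J"
        by simp
      then show ?thesis
        unfolding x(2) uelt_le_iff[OF t x(1) p]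
        using weaken_top[OF X _ nil_ctx] le_top[OF over_obj[OF X t] weaken_closed[OF t x(1) X]]
        by (intro bexI[OF _ X]) simp
    qed
    then show ?case
      using p uelt_closed[OF p] by (intro exI[of _ "\<top>\<^bsub>over [] ?t\<^esub>"] exI[of _ "[]"]) (auto simp: greatest_def)
  next
    case (insert v U)
    obtain B j where v [simp]: "v = (B, j)" and B: "B \<in> Obj (Base D)" and j: "j \<in> Field r"
      using insert.prems by auto
    obtain \<gamma> X where p: "(\<gamma>, X) \<in> pres ?t" and X: "set X = (\<Union>(B, j) \<in> U. set (star r L B j))"
      and glb: "greatest u (uelt D r ?t \<gamma> X) (Lower u (henkin_elt D r L ` U))"
      using insert by auto
    note hp = henkin_elt_pres[OF B j]
    have "X \<in> J"
      using p by simp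
    obtain Z where Z: "Z \<in> J" "set Z = set X \<union> set (star r L B j)"
      using \<open>X \<in> J\<close> star_ctx[OF B j] by (rule ctxs_join)
    then have sZ: "set X \<subseteq> set Z" "set (star r L B j) \<subseteq> set Z"
      by auto
    define \<alpha> where "\<alpha> = weaken Z X ?t \<gamma>"
    define \<beta> where "\<beta> = weaken Z (star r L B j) ?t (lift (star r L B j) (henkin D L B j))"
    have ab: "(\<alpha>, Z) \<in> pres ?t" "(\<beta>, Z) \<in> pres ?t"
      unfolding \<alpha>_def \<beta>_def using weaken_closed[OF t p Z(1) sZ(1)] weaken_closed[OF t hp Z(1) sZ(2)] Z(1)
      by simp_all
    have \<alpha>: "uelt D r ?t \<alpha> Z = uelt D r ?t \<gamma> X" and \<beta>: "uelt D r ?t \<beta> Z = henkin_elt D r L v"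
      unfolding \<alpha>_def \<beta>_def using uelt_weaken[OF t p Z(1) sZ(1)] uelt_weaken[OF t hp Z(1) sZ(2)]
      by (simp_all add: henkin_elt_eq)
    interpret Z: lower_semilattice "over Z ?t"
      by (rule fib_meets[OF over_obj[OF Z(1) t]])
    have m: "(\<alpha> \<sqinter>\<^bsub>over Z ?t\<^esub> \<beta>, Z) \<in> pres ?t"
      using ab by simp
    have c: "uelt D r ?t \<gamma> X \<in> carrier u" "henkin_elt D r L v \<in> carrier u"
      using uelt_closed[OF ab(1)] uelt_closed[OF ab(2)] \<alpha> \<beta> by simp_all
    have "henkin_elt D r L ` U \<subseteq> carrier u"
      using insert.prems uelt_closed[OF henkin_elt_pres] by (auto simp: henkin_elt_eq)
    have "greatest u (uelt D r ?t \<gamma> X \<sqinter>\<^bsub>u\<^esub> henkin_elt D r L v) (Lower u (insert (henkin_elt D r L v) (henkin_elt D r L ` U)))"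
    proof (rule greatest_LowerI)
      show "uelt D r ?t \<gamma> X \<sqinter>\<^bsub>u\<^esub> henkin_elt D r L v \<sqsubseteq>\<^bsub>u\<^esub> x"
        if x: "x \<in> insert (henkin_elt D r L v) (henkin_elt D r L ` U)" for x
      proof (cases "x = henkin_elt D r L v")
        case False
        then have "x \<in> henkin_elt D r L ` U"
          using x by simp
        then have "uelt D r ?t \<gamma> X \<sqsubseteq>\<^bsub>u\<^esub> x" "x \<in> carrier u"
          using greatest_Lower_below[OF glb] \<open>henkin_elt D r L ` U \<subseteq> carrier u\<close> by auto
        then show ?thesis
          using u.le_trans[OF u.meet_left[OF c]] c by simp
      next
        case True
        then show ?thesis
          using u.meet_right[OF c] by simp
      qed
      show "y \<sqsubseteq>\<^bsub>u\<^esub> uelt D r ?t \<gamma> X \<sqinter>\<^bsub>u\<^esub> henkin_elt D r L v"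
        if y: "y \<in> Lower u (insert (henkin_elt D r L v) (henkin_elt D r L ` U))" for y
      proof -
        have "y \<in> carrier u" "y \<sqsubseteq>\<^bsub>u\<^esub> henkin_elt D r L v" "y \<in> Lower u (henkin_elt D r L ` U)"
          using y c unfolding Lower_def by auto
        then show ?thesis
          using greatest_le[OF glb] c by (simp add: u.le_meet_iff)
      qed
    qed (use c \<open>henkin_elt D r L ` U \<subseteq> carrier u\<close> in auto)
    then have "greatest u (uelt D r ?t (\<alpha> \<sqinter>\<^bsub>over Z ?t\<^esub> \<beta>) Z) (Lower u (henkin_elt D r L ` insert v U))"
      using uelt_meet[OF t ab] \<alpha> \<beta> by simp
    moreover have "set Z = (\<Union>(B, j) \<in> insert v U. set (star r L B j))"
      using X Z(2) by auto
    ultimately show ?case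
      using m by blast
  qed
  then obtain \<gamma> X where p: "(\<gamma>, X) \<in> pres ?t" "set X = (\<Union>(B, j) \<in> U. set (star r L B j))"
    and glb: "greatest u (uelt D r ?t \<gamma> X) (Lower u (henkin_elt D r L ` U))"
    by blast
  \<comment> \<open>\<open>henkin_meet\<close> chooses some greatest lower bound; the one
    constructed above shows that the choice succeeds.\<close>
  have g: "greatest u (henkin_meet D r L U) (Lower u (henkin_elt D r L ` U))"
  proof -
    have "henkin_meet D r L U = (SOME x. greatest u x (Lower u (henkin_elt D r L ` U)))"
      by (simp add: henkin_meet_def inf_def udoc_def ucat_def)
    then show ?thesis
      using someI[where P = "\<lambda>x. greatest u x (Lower u (henkin_elt D r L ` U))", OF glb] by simp
  qed
  show thesis
    by (rule that[OF p _ g]) (rule u.greatest_unique[OF g glb])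
qed

lemma
  assumes "U \<in> axiom_sets D r"
  shows henkin_meet_closed: "henkin_meet D r L U \<in> carrier u"
    and le_henkin_meet_iff: "x \<in> carrier u \<Longrightarrow>
      x \<sqsubseteq>\<^bsub>u\<^esub> henkin_meet D r L U \<longleftrightarrow> (\<forall>v \<in> U. x \<sqsubseteq>\<^bsub>u\<^esub> henkin_elt D r L v)"
proof -
  have U: "finite U" "U \<subseteq> Obj (Base D) \<times> Field r"
    using assms by (auto simp: axiom_sets_def)
  have g: "greatest u (henkin_meet D r L U) (Lower u (henkin_elt D r L ` U))"
    using henkin_meet_glb[OF U] by blast
  have c: "henkin_elt D r L ` U \<subseteq> carrier u"
    using U(2) uelt_closed[OF henkin_elt_pres] by (auto simp: henkin_elt_eq)
  show m: "henkin_meet D r L U \<in> carrier u"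
    using g by (rule greatest_closed)
  show "x \<sqsubseteq>\<^bsub>u\<^esub> henkin_meet D r L U \<longleftrightarrow> (\<forall>v \<in> U. x \<sqsubseteq>\<^bsub>u\<^esub> henkin_elt D r L v)" if x: "x \<in> carrier u"
  proof
    assume le: "x \<sqsubseteq>\<^bsub>u\<^esub> henkin_meet D r L U"
    show "\<forall>v \<in> U. x \<sqsubseteq>\<^bsub>u\<^esub> henkin_elt D r L v"
      using greatest_Lower_below[OF g _ c] u.le_trans[OF le _ x m] c by auto
  next
    assume "\<forall>v \<in> U. x \<sqsubseteq>\<^bsub>u\<^esub> henkin_elt D r L v"
    with x show "x \<sqsubseteq>\<^bsub>u\<^esub> henkin_meet D r L U"
      by (intro greatest_le[OF g] Lower_memI) auto
  qed
qed

lemma henkin_meet_antimono: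
  assumes "U \<in> axiom_sets D r" "V \<in> axiom_sets D r" "U \<subseteq> V"
  shows "henkin_meet D r L V \<sqsubseteq>\<^bsub>u\<^esub> henkin_meet D r L U"
  using le_henkin_meet_iff[OF assms(2) henkin_meet_closed[OF assms(2)]]
    le_henkin_meet_iff[OF assms(1) henkin_meet_closed[OF assms(2)]]
    u.le_refl[OF henkin_meet_closed[OF assms(2)]] assms(3)
  by auto

text \<open>The induction is on the cardinality, because the axiom to be split off cannot be an
  arbitrary last insertion: it has to be one with maximal witness.\<close>

lemma henkin_meet_not_le_ubot:
  "U \<in> axiom_sets D r \<Longrightarrow> \<not> henkin_meet D r L U \<sqsubseteq>\<^bsub>u\<^esub> ubot"
proof (induction "card U" arbitrary: U)
  let ?t = "Trm (Base D)"
  note t = cat.trm_obj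
  case 0
  then have U: "U = {}"
    by (auto simp: axiom_sets_def)
  have p: "(\<top>\<^bsub>over [] ?t\<^esub>, []) \<in> pres ?t"
    using nil_ctx top_mem[OF over_obj[OF nil_ctx t]] by simp
  \<comment> \<open>Falsity could appear at any list, so non-triviality is applied to the fiber over
    an arbitrary one.\<close>
  have "\<not> uelt D r ?t \<top>\<^bsub>over [] ?t\<^esub> [] \<sqsubseteq>\<^bsub>u\<^esub> ubot"
    unfolding le_ubot_iff[OF p]
    using weaken_top[OF _ _ nil_ctx] not_top_le_bottom[OF over_obj[OF _ t] nontrivial[OF over_obj[OF _ t]]]
    by auto
  moreover have "uelt D r ?t \<top>\<^bsub>over [] ?t\<^esub> [] \<sqsubseteq>\<^bsub>u\<^esub> henkin_meet D r L U"
    unfolding le_henkin_meet_iff[OF 0(2) uelt_closed[OF p]] by (simp add: U)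
  ultimately show ?case
    using u.le_trans[OF _ _ uelt_closed[OF p] henkin_meet_closed[OF 0(2)] ubot_closed] by blast
next
  case (Suc n)
  have fin: "finite U" and U: "U \<subseteq> Obj (Base D) \<times> Field r"
    using Suc.prems by (auto simp: axiom_sets_def)
  have "U \<noteq> {}" "(\<lambda>(B, j). witness r L B j) ` U \<subseteq> Field r"
    using Suc.hyps(2) U witness_Field by auto
  from wo.finite_has_max[OF fin this] obtain B j where v: "(B, j) \<in> U"
    and max: "\<And>A k. (A, k) \<in> U \<Longrightarrow> (witness r L A k, witness r L B j) \<in> r"
    by fastforce
  have B: "B \<in> Obj (Base D)" and j: "j \<in> Field r"
    using v U by auto
  define V where "V = U - {(B, j)}"
  have V: "V \<in> axiom_sets D r" "finite V" "V \<subseteq> Obj (Base D) \<times> Field r"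
    using Suc.prems by (auto simp: V_def axiom_sets_def)
  obtain \<gamma> X where p: "(\<gamma>, X) \<in> pres (Trm (Base D))"
    and X: "set X = (\<Union>(B, j) \<in> V. set (star r L B j))"
    and m: "henkin_meet D r L V = uelt D r (Trm (Base D)) \<gamma> X"
    by (rule henkin_meet_glb[OF V(2,3)])
  \<comment> \<open>Only the constants of the remaining axioms occur in \<open>X\<close>, and
    maximality of the witness keeps the new constant out of each of them.\<close>
  have fresh: "(B, witness r L B j) \<notin> set X"
    using maximal_witness_fresh[OF U v max] by (auto simp: X V_def)
  have c: "henkin_meet D r L V \<in> carrier u" "henkin_elt D r L (B, j) \<in> carrier u"
    using henkin_meet_closed[OF V(1)] uelt_closed[OF henkin_elt_pres[OF B j]] by (simp_all add: henkin_elt_eq)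
  have "\<not> henkin_meet D r L V \<sqsubseteq>\<^bsub>u\<^esub> ubot"
    using Suc.hyps(2) v fin by (intro Suc.hyps(1) V(1)) (simp add: V_def)
  then have "\<not> henkin_meet D r L V \<sqinter>\<^bsub>u\<^esub> henkin_elt D r L (B, j) \<sqsubseteq>\<^bsub>u\<^esub> ubot"
    using henkin_axiom_conservative[OF B j p fresh] unfolding m by blast
  moreover have "henkin_meet D r L V \<sqinter>\<^bsub>u\<^esub> henkin_elt D r L (B, j) \<sqsubseteq>\<^bsub>u\<^esub> henkin_meet D r L U"
    unfolding le_henkin_meet_iff[OF Suc.prems u.meet_closed[OF c]]
  proof
    fix w
    assume w: "w \<in> U"
    have "henkin_meet D r L V \<sqinter>\<^bsub>u\<^esub> henkin_elt D r L (B, j) \<sqsubseteq>\<^bsub>u\<^esub> henkin_elt D r L w" if "w \<noteq> (B, j)"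
    proof -
      have "w \<in> V"
        using w that by (simp add: V_def)
      then show ?thesis
        using le_henkin_meet_iff[OF V(1) u.meet_closed[OF c]] u.meet_left[OF c] by blast
    qed
    then show "henkin_meet D r L V \<sqinter>\<^bsub>u\<^esub> henkin_elt D r L (B, j) \<sqsubseteq>\<^bsub>u\<^esub> henkin_elt D r L w"
      using u.meet_right[OF c] by blast
  qed
  ultimately show ?case
    using u.le_trans[OF _ _ u.meet_closed[OF c] henkin_meet_closed[OF Suc.prems] ubot_closed] by blast
qed

section \<open>From finite sets of axioms to the quotient doctrine\<close>

lemma henkin_at_Trm:
  "U \<in> axiom_sets D r \<Longrightarrow> henkin_at D r L (Trm (Base D)) U = henkin_meet D r L U"
  unfolding henkin_at_def using rdx_bang_udoc[OF henkin_meet_closed] by (simp add: udoc_def)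

lemma hdom_Trm_iff:
  "(a, U) \<in> hdom D r L (Trm (Base D)) \<longleftrightarrow>
    U \<in> axiom_sets D r \<and> a \<in> carrier u \<and> a \<sqsubseteq>\<^bsub>u\<^esub> henkin_meet D r L U"
  by (auto simp: hdom_def henkin_at_Trm udoc_def)

lemma helt_relE:
  assumes "((a, U), (b, V)) \<in> helt_rel D r L (Trm (Base D))"
  obtains W where "W \<in> axiom_sets D r" "b \<in> carrier u"
    "a \<sqinter>\<^bsub>u\<^esub> henkin_meet D r L W = b \<sqinter>\<^bsub>u\<^esub> henkin_meet D r L W"
  using assms henkin_at_Trm by (auto simp: helt_rel_def hdom_Trm_iff udoc_def)

text \<open>The classes of truth and falsum are separated. An inequality between them may use other
  representatives, each tied to the original only modulo finitely many axioms; collecting all these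
  axioms would make a finite set of them inconsistent.\<close>

theorem consistent_hdoc: "consistent (hdoc D r L)"
proof -
  let ?t = "Trm (Base D)"
  let ?H = "henkin_meet D r L"
  have E: "{} \<in> axiom_sets D r"
    by (simp add: axiom_sets_def)
  \<comment> \<open>The empty meet is the greatest element of \<open>u\<close>, so both truth and
    falsum are admissible with no axioms assumed.\<close>
  define p where "p = helt_rel D r L ?t `` {(?H {}, {})}"
  define q where "q = helt_rel D r L ?t `` {(ubot, {})}"
  have "(?H {}, {}) \<in> hdom D r L ?t" "(ubot, {}) \<in> hdom D r L ?t"
    using E henkin_meet_closed[OF E] ubot_closed le_henkin_meet_iff[OF E] by (simp_all add: hdom_Trm_iff)
  then have "p \<in> carrier (hfib D r L ?t)" "q \<in> carrier (hfib D r L ?t)"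
    by (auto simp: hfib_def p_def q_def intro: quotientI)
  moreover have "\<not> p \<sqsubseteq>\<^bsub>hfib D r L ?t\<^esub> q"
  proof
    assume "p \<sqsubseteq>\<^bsub>hfib D r L ?t\<^esub> q"
    then obtain a U b V W where "(a, U) \<in> p" "(b, V) \<in> q" and W: "W \<in> axiom_sets D r"
      and le: "a \<sqinter>\<^bsub>u\<^esub> ?H W \<sqsubseteq>\<^bsub>u\<^esub> b \<sqinter>\<^bsub>u\<^esub> ?H W"
      by (auto simp: hfib_def henkin_at_Trm udoc_def)
    then have ab: "((?H {}, {}), (a, U)) \<in> helt_rel D r L ?t" "((ubot, {}), (b, V)) \<in> helt_rel D r L ?t"
      by (simp_all add: p_def q_def)
    obtain W1 where W1: "W1 \<in> axiom_sets D r" and a: "a \<in> carrier u" "?H {} \<sqinter>\<^bsub>u\<^esub> ?H W1 = a \<sqinter>\<^bsub>u\<^esub> ?H W1"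
      using ab(1) by (rule helt_relE)
    obtain W2 where W2: "W2 \<in> axiom_sets D r" and b: "b \<in> carrier u" "ubot \<sqinter>\<^bsub>u\<^esub> ?H W2 = b \<sqinter>\<^bsub>u\<^esub> ?H W2"
      using ab(2) by (rule helt_relE)
    \<comment> \<open>One set of axioms for all three comparisons: its meet lies below those of
      \<open>W\<close>, \<open>W1\<close> and \<open>W2\<close>, so it can be carried from truth
      through \<open>a\<close> and \<open>b\<close> to falsum.\<close>
    define S where "S = W \<union> W1 \<union> W2"
    have S: "S \<in> axiom_sets D r"
      using W W1 W2 by (auto simp: S_def axiom_sets_def)
    note c = henkin_meet_closed[OF S] henkin_meet_closed[OF E] henkin_meet_closed[OF W]
      henkin_meet_closed[OF W1] henkin_meet_closed[OF W2] ubot_closed a(1) b(1)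
    have SH: "?H S \<sqsubseteq>\<^bsub>u\<^esub> ?H {}" "?H S \<sqsubseteq>\<^bsub>u\<^esub> ?H W" "?H S \<sqsubseteq>\<^bsub>u\<^esub> ?H W1" "?H S \<sqsubseteq>\<^bsub>u\<^esub> ?H W2"
      using henkin_meet_antimono[OF _ S] E W W1 W2 by (auto simp: S_def)
    have "?H S \<sqsubseteq>\<^bsub>u\<^esub> a \<sqinter>\<^bsub>u\<^esub> ?H W1"
      unfolding a(2)[symmetric] using SH c by (simp add: u.le_meet_iff)
    then have "?H S \<sqsubseteq>\<^bsub>u\<^esub> a \<sqinter>\<^bsub>u\<^esub> ?H W"
      using SH c by (simp add: u.le_meet_iff)
    then have "?H S \<sqsubseteq>\<^bsub>u\<^esub> b \<sqinter>\<^bsub>u\<^esub> ?H W"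
      using u.le_trans[OF _ le c(1) u.meet_closed[OF c(7,3)] u.meet_closed[OF c(8,3)]] by blast
    then have "?H S \<sqsubseteq>\<^bsub>u\<^esub> b \<sqinter>\<^bsub>u\<^esub> ?H W2"
      using SH c by (simp add: u.le_meet_iff)
    then have "?H S \<sqsubseteq>\<^bsub>u\<^esub> ubot"
      unfolding b(2)[symmetric] using c by (simp add: u.le_meet_iff)
    then show False
      using henkin_meet_not_le_ubot[OF S] by blast
  qed
  ultimately show ?thesis
    unfolding consistent_def by (auto simp: hdoc_def udoc_def ucat_def)
qed

end

theorem proposition3p21:
  fixes P :: "('o, 'a, 'p) doctrine_data"
    and r :: "'l rel"
    and L :: "('o, 'p, 'l) listing"
  assumes "bounded_doctrine P" and "existential_doctrine P" and "implicational_doctrine P"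
    and nontrivial: "\<And>A. A \<in> Obj (Base P) \<Longrightarrow> \<not> is_singleton (carrier (Fib P A))"
    and Lambda: "(r, card_of (SIGMA X : Obj (Base P). carrier (Fib P X))) \<in> ordIso"
    and listing: "is_listing P r L"
  shows "consistent (hdoc P r L)"
proof -
  interpret bounded_doctrine P by fact
  interpret existential_doctrine P by fact
  interpret implicational_doctrine P by fact
  have "Well_order r"
    using Lambda by (auto simp: ordIso_def)
  then interpret henkin_construction P r L
    using nontrivial listing by unfold_locales
  show ?thesis
    by (rule consistent_hdoc)
qed

end
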